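(* Consider the triangle query $T(x,y,z)\leftarrow E(x,y),E(x,z),E(y,z)$ with key order $x,y,z$ on a binary edge relation $E$, and let $K$ be the size of the output. The boxed Leapfrog Triejoin (boxed LFTJ) applied to this query has an I/O complexity of $$O\!\left(\frac{|E|^3}{M^2B}+\frac{K}{B}\right).$$ If there are no spills, the I/O complexity is $$O\!\left(\frac{|E|^2}{MB}+\frac{K}{B}\right).$$
   Context: **Cost model.** Main memory holds $M$ words (one atomic value per word); secondary storage is read/written in blocks of $B$ words, each block read or write costing 1 I/O. Input, intermediary and output data can exceed $M$. Standing assumptions: $|E|/B>\log|E|$, and $M/B$ is larger than, say, 10 times the number of atoms times their maximum arity. **Input.** $E$ is the edge relation of the directed version of a simple undirected graph: for each edge $\{a,b\}$, $E$ contains the pair $(\min\{a,b\},\max\{a,b\})$. **In-memory LFTJ** on the triangle query: for each $a\in V_1=\{u : (u,v)\in E\}$, for each $b\in V_1\cap D(a)$, for each $c\in D(a)\cap D(b)$, output $(a,b,c)$, where $D(v)=\{u:(v,u)\in E\}$. **TrieArrays and slices.** The trie of a $k$-ary relation $R$ stores each tuple as a root-to-leaf path, with distinct increasingly ordered children at each node. Its TrieArray consists of value arrays $\mathbf{val}_0,\dots,\mathbf{val}_{k-1}$ ($\mathbf{val}_i$ lists the trie nodes of the $i$-th column in lexicographic order, columns counted from 0) and index arrays $\mathbf{idx}_0,\dots,\mathbf{idx}_{k-2}$, where $\mathbf{idx}_i[j]$ is the position in $\mathbf{val}_{i+1}$ at which the children of node $\mathbf{val}_i[j]$ start (they end just before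 position $\mathbf{idx}_i[j+1]$). $E$ is given on secondary storage as a TrieArray. For a tuple $s$ of length $p$ and values $l,h$, the slice $R^s_{l\to h}$ is $\{(t_0,\dots,t_{k-1})\in R : (t_0,\dots,t_{p-1})=s,\ l\le t_p\le h\}$. *Provisioning* a slice means copying its TrieArray (contiguous ranges of the arrays of $R$, with offset-adjusted index arrays) into memory. *Probing* $R$ with $s$, $l$ and a budget of $b$ blocks returns the maximal $h\ge l$ such that $R^s_{l\to h}$ occupies at most $b$ blocks, or SPILL if no such $h$ exists. Upper-bound values are found by binary search in the value arrays. **Boxed LFTJ** for a query with variables $x_1,\dots,x_n$ in key order (here $n=3$ and $(x_1,x_2,x_3)=(x,y,z)$). The available memory is divided evenly among the $n$ dimensions (a constant-size output buffer is kept for writing the output append-only; memory unused at one dimension may be passed to the next). Each atom is assigned to the dimension $i$ such that $x_i$ is its first variable; let $\mathrm{atoms}[i]$ be this set (here $\mathrm{atoms}[1]=\{E(x,y),E(x,z)\}$, $\mathrm{atoms}[2]=\{E(y,z)\}$, $\mathrm{atoms}[3]=\emptyset$). The recursive procedure BoxUp$(i)$, started with BoxUp$(1)$, sets $\mathrm{low}[i]=-\infty$ and repeats: (1) divide the memory of dimension $i$ evenly among all atoms to be handled at dimension $i$ (those in $\mathrm{atoms}[i]$ plus atoms spilled from earlier dimensions whose next attribute is $x_i$), and probe each from $\mathrm{low}[i]$ (with start tuple empty for atoms in $\mathrm{atoms}[i]$, and equal to the fixed prefix for spilled atoms); let $\mathrm{high}[i]$ be the minimum of the returned upper bounds; if an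 atom returns SPILL, set $\mathrm{high}[i]=\mathrm{low}[i]$ and mark this atom, restricted to its current attribute having the value $\mathrm{low}[i]$, as spilled, to be handled instead at the dimension of its next attribute; (2) provision the slices from $\mathrm{low}[i]$ to $\mathrm{high}[i]$ of all non-spilled atoms handled at dimension $i$ (blocks at slice boundaries are cached so that one complete pass reads each input block once); (3) if $i<n$ call BoxUp$(i+1)$, otherwise run in-memory LFTJ on all currently provisioned slices, i.e. on the box $\prod_j[\mathrm{low}[j],\mathrm{high}[j]]$; (4) set $\mathrm{low}[i]$ to the successor of $\mathrm{high}[i]$; until $\mathrm{high}[i]=\infty$. "No spills" means that no probe during the execution returns SPILL.
   Formalization: The formal bounds assume M ≤ κ|E| for an arbitrary fixed κ (the constant depends on κ), since they fail when M far exceeds |E|; each binary search is confined to a window of as many entries as the probe's block budget can hold, since whole-array searches can exceed the bounds. *)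

theory Defs
  imports Complex_Main "HOL-Library.Extended_Nat" "HOL-Library.Monad_Syntax"
begin

section \<open>Input and query\<close>

text \<open>Values are natural numbers (one word each).  The sentinel \<open>-\<infinity>\<close> is represented by 0,
  the least value of the domain, and \<open>\<infinity>\<close> by the top element of \<^typ>\<open>enat\<close>.\<close>

type_synonym graph = "(nat \<times> nat) set"

definition edge_relation :: "graph \<Rightarrow> bool" where
  "edge_relation E \<longleftrightarrow>
     (\<exists>G :: nat set set. finite G \<and> (\<forall>e\<in>G. card e = 2) \<and> E = (\<lambda>e. (Min e, Max e)) ` G)"

definition V1 :: "graph \<Rightarrow> nat set" where
  "V1 E = {u. \<exists>v. (u, v) \<in> E}"

definition D :: "graph \<Rightarrow> nat \<Rightarrow> nat set" where
  "D E v = {u. (v, u) \<in> E}"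

definition triangles :: "graph \<Rightarrow> (nat \<times> nat \<times> nat) set" where
  "triangles E = {(x, y, z). (x, y) \<in> E \<and> (x, z) \<in> E \<and> (y, z) \<in> E}"

section \<open>TrieArrays, slices and blocks\<close>

record trie_array =
  val0 :: "nat list"
  idx0 :: "nat list"
  val1 :: "nat list"

text \<open>The index array carries a final sentinel entry, so that the children of the node at
  position \<open>j\<close> always end just before the entry at position \<open>j + 1\<close>.\<close>

definition trie :: "graph \<Rightarrow> trie_array" where
  "trie R = (let vs = sorted_list_of_set (V1 R) in
     \<lparr> val0 = vs,
       idx0 = map (\<lambda>j. \<Sum>v\<leftarrow>take j vs. card (D R v)) [0..<Suc (length vs)],
       val1 = concat (map (\<lambda>v. sorted_list_of_set (D R v)) vs) \<rparr>)"

text \<open>Number of blocks that a TrieArray occupies, each array starting at a block boundary.\<close>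

definition trie_blocks :: "nat \<Rightarrow> trie_array \<Rightarrow> nat" where
  "trie_blocks B T = (\<Sum>n\<leftarrow>[length (val0 T), length (idx0 T), length (val1 T)].
     nat \<lceil>real n / real B\<rceil>)"

text \<open>The start tuple of a slice of a binary relation has length 0 (\<^const>\<open>None\<close>) or
  length 1 (\<^term>\<open>Some v\<close>).\<close>

type_synonym start = "nat option"

definition slice :: "graph \<Rightarrow> start \<Rightarrow> nat \<Rightarrow> enat \<Rightarrow> graph" where
  "slice R s l h = (case s of
       None \<Rightarrow> {(t0, t1) \<in> R. l \<le> t0 \<and> enat t0 \<le> h}
     | Some v \<Rightarrow> {(t0, t1) \<in> R. t0 = v \<and> l \<le> t1 \<and> enat t1 \<le> h})"

definition fits :: "graph \<Rightarrow> nat \<Rightarrow> start \<Rightarrow> nat \<Rightarrow> nat \<Rightarrow> enat \<Rightarrow> bool" where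
  "fits R B s l b h \<longleftrightarrow> trie_blocks B (trie (slice R s l h)) \<le> b"

text \<open>The result \<^const>\<open>None\<close> stands for SPILL.  For finite \<open>R\<close> the maximum is attained, because
  a slice that fits for every finite upper bound also fits for \<open>\<infinity>\<close>.\<close>

definition probe :: "graph \<Rightarrow> nat \<Rightarrow> start \<Rightarrow> nat \<Rightarrow> nat \<Rightarrow> enat option" where
  "probe R B s l b =
     (if \<exists>h\<ge>enat l. fits R B s l b h
      then Some (GREATEST h. enat l \<le> h \<and> fits R B s l b h) else None)"

section \<open>Accesses to secondary storage\<close>

datatype array = Val0 | Idx0 | Val1

type_synonym block = "array \<times> nat"

definition row :: "graph \<Rightarrow> nat \<Rightarrow> nat" where
  "row R v = card {u \<in> V1 R. u < v}"

definition child_range :: "graph \<Rightarrow> start \<Rightarrow> nat \<times> nat" where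
  "child_range R s = (case s of
       None \<Rightarrow> (0, length (val0 (trie R)))
     | Some v \<Rightarrow> (idx0 (trie R) ! row R v, idx0 (trie R) ! Suc (row R v)))"

definition entry :: "graph \<Rightarrow> start \<Rightarrow> nat \<Rightarrow> nat" where
  "entry R s q = (case s of None \<Rightarrow> val0 (trie R) ! q | Some _ \<Rightarrow> val1 (trie R) ! q)"

text \<open>Position of the first entry \<open>\<ge> l\<close> below the start tuple.  In an execution this position is
  known without further accesses: it is the start of the child range at the beginning of a pass,
  and the end of the preceding slice (or the position after the spilled entry) afterwards.\<close>

definition pos :: "graph \<Rightarrow> start \<Rightarrow> nat \<Rightarrow> nat" where
  "pos R s l = (let (lo, hi) = child_range R s in
     LEAST q. lo \<le> q \<and> (q < hi \<longrightarrow> l \<le> entry R s q))"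

text \<open>The positions inspected by binary search for the first position in \<open>[lo, hi)\<close> at which \<open>P\<close>
  fails.\<close>

function bsearch :: "(nat \<Rightarrow> bool) \<Rightarrow> nat \<Rightarrow> nat \<Rightarrow> nat list" where
  "bsearch P lo hi =
     (if lo < hi then
        let m = (lo + hi) div 2
        in m # (if P m then bsearch P (Suc m) hi else bsearch P lo m)
      else [])"
  by pat_completeness auto
termination
  by (relation "Wellfounded.measure (\<lambda>(P, lo, hi). hi - lo)") auto

text \<open>A slice of at most \<open>b\<close> blocks has at most \<open>b * B\<close> entries in the searched array, so all
  searches are confined to a window of that many entries.\<close>

definition window_end :: "graph \<Rightarrow> nat \<Rightarrow> start \<Rightarrow> nat \<Rightarrow> nat \<Rightarrow> nat" where
  "window_end R B s l b = min (snd (child_range R s)) (pos R s l + b * B)"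

definition entry_block :: "nat \<Rightarrow> start \<Rightarrow> nat \<Rightarrow> block" where
  "entry_block B s q = (case s of None \<Rightarrow> (Val0, q div B) | Some _ \<Rightarrow> (Val1, q div B))"

text \<open>Besides the inspected values, probing reads the index entries that determine the size of the
  inspected slices (empty start tuple) or the child range to be searched (unary start tuple).\<close>

definition probe_blocks :: "graph \<Rightarrow> nat \<Rightarrow> start \<Rightarrow> nat \<Rightarrow> nat \<Rightarrow> block set" where
  "probe_blocks R B s l b =
     (let ms = set (bsearch (\<lambda>m. fits R B s l b (enat (entry R s m)))
                      (pos R s l) (window_end R B s l b))
      in entry_block B s ` ms \<union>
         (\<lambda>q. (Idx0, q div B)) `
           (case s of None \<Rightarrow> insert (pos R s l) (Suc ` ms) | Some v \<Rightarrow> {row R v, Suc (row R v)}))"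

text \<open>Blocks read to find the end of the slice with the upper bound \<open>h\<close>, which may be smaller
  than the one returned by the probe.\<close>

definition locate_blocks :: "graph \<Rightarrow> nat \<Rightarrow> start \<Rightarrow> nat \<Rightarrow> nat \<Rightarrow> enat \<Rightarrow> block set" where
  "locate_blocks R B s l b h =
     entry_block B s ` set (bsearch (\<lambda>m. enat (entry R s m) \<le> h) (pos R s l) (window_end R B s l b))"

text \<open>Positions, in the stored arrays of \<open>R\<close>, of the trie nodes of a slice \<open>S\<close>; they form contiguous
  ranges.\<close>

definition slice_rows :: "graph \<Rightarrow> graph \<Rightarrow> nat set" where
  "slice_rows R S = {j. j < length (val0 (trie R)) \<and> val0 (trie R) ! j \<in> V1 S}"

definition slice_cells :: "graph \<Rightarrow> graph \<Rightarrow> nat set" where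
  "slice_cells R S = {q. \<exists>j\<in>slice_rows R S. idx0 (trie R) ! j \<le> q \<and> q < idx0 (trie R) ! Suc j \<and>
     (val0 (trie R) ! j, val1 (trie R) ! q) \<in> S}"

definition slice_blocks :: "graph \<Rightarrow> nat \<Rightarrow> graph \<Rightarrow> block set" where
  "slice_blocks R B S =
     (\<lambda>j. (Val0, j div B)) ` slice_rows R S \<union>
     (\<lambda>j. (Idx0, j div B)) ` (slice_rows R S \<union> Suc ` slice_rows R S) \<union>
     (\<lambda>q. (Val1, q div B)) ` slice_cells R S"

text \<open>The last block of each array range of \<open>S\<close>.  It stays cached for the next slice of the pass;
  an empty slice leaves the cached blocks unchanged.\<close>

definition boundary_blocks :: "graph \<Rightarrow> nat \<Rightarrow> graph \<Rightarrow> block set \<Rightarrow> block set" where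
  "boundary_blocks R B S old =
     (if S = {} then old
      else {(Val0, Max (slice_rows R S) div B), (Idx0, Suc (Max (slice_rows R S)) div B),
            (Val1, Max (slice_cells R S) div B)})"

section \<open>Boxed Leapfrog Triejoin for the triangle query\<close>

text \<open>The variables \<open>x, y, z\<close> are numbered 1, 2, 3; an atom over the edge relation is the pair of
  its variables.\<close>

type_synonym atom = "nat \<times> nat"

definition atoms :: "atom list" where
  "atoms = [(1, 2), (1, 3), (2, 3)]"

definition lftj :: "(atom \<Rightarrow> graph) \<Rightarrow> (nat \<times> nat \<times> nat) list" where
  "lftj R =
     [(a, b, c).
        a \<leftarrow> sorted_list_of_set (V1 (R (1, 2)) \<inter> V1 (R (1, 3))),
        b \<leftarrow> sorted_list_of_set (V1 (R (2, 3)) \<inter> D (R (1, 2)) a),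
        c \<leftarrow> sorted_list_of_set (D (R (1, 3)) a \<inter> D (R (2, 3)) b)]"

text \<open>An atom to be handled at some dimension, with the start tuple of its slices: empty at the
  dimension of its first variable, and the spilled value at the dimension of its second one.\<close>

type_synonym item = "atom \<times> start"

definition items_at :: "nat \<Rightarrow> item list \<Rightarrow> item list" where
  "items_at i sp = [(a, None). a \<leftarrow> atoms, fst a = i] @ [(a, s). (a, s) \<leftarrow> sp, snd a = i]"

definition spilled_items :: "graph \<Rightarrow> nat \<Rightarrow> nat \<Rightarrow> nat \<Rightarrow> item list \<Rightarrow> item list" where
  "spilled_items E B b l its = filter (\<lambda>(a, s). probe E B s l b = None) its"

definition kept_items :: "graph \<Rightarrow> nat \<Rightarrow> nat \<Rightarrow> nat \<Rightarrow> item list \<Rightarrow> item list" where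
  "kept_items E B b l its = filter (\<lambda>(a, s). probe E B s l b \<noteq> None) its"

text \<open>If there is no atom to be handled, the upper bound is \<open>Inf {} = \<infinity>\<close>.\<close>

definition high :: "graph \<Rightarrow> nat \<Rightarrow> nat \<Rightarrow> nat \<Rightarrow> item list \<Rightarrow> enat" where
  "high E B b l its =
     (if spilled_items E B b l its \<noteq> [] then enat l
      else Inf ((\<lambda>(a, s). the (probe E B s l b)) ` set its))"

definition step_reads ::
  "graph \<Rightarrow> nat \<Rightarrow> nat \<Rightarrow> nat \<Rightarrow> enat \<Rightarrow> item list \<Rightarrow> (item \<Rightarrow> block set) \<Rightarrow> nat" where
  "step_reads E B b l h its cache =
     (\<Sum>(a, s)\<leftarrow>its. card (probe_blocks E B s l b)) +
     (\<Sum>(a, s)\<leftarrow>kept_items E B b l its.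
        card (locate_blocks E B s l b h) +
        card (slice_blocks E B (slice E s l h) - cache (a, s)))"

definition provision ::
  "graph \<Rightarrow> nat \<Rightarrow> enat \<Rightarrow> item list \<Rightarrow> (atom \<Rightarrow> graph) \<Rightarrow> atom \<Rightarrow> graph" where
  "provision E l h kept prov =
     fold (\<lambda>(a, s) f. f(a := slice E s l h)) kept prov"

definition update_cache ::
  "graph \<Rightarrow> nat \<Rightarrow> nat \<Rightarrow> enat \<Rightarrow> item list \<Rightarrow> (item \<Rightarrow> block set) \<Rightarrow> item \<Rightarrow> block set" where
  "update_cache E B l h kept cache = (\<lambda>(a, s).
     if (a, s) \<in> set kept then boundary_blocks E B (slice E s l h) (cache (a, s))
     else cache (a, s))"

definition used_blocks :: "graph \<Rightarrow> nat \<Rightarrow> nat \<Rightarrow> enat \<Rightarrow> item list \<Rightarrow> nat" where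
  "used_blocks E B l h kept = (\<Sum>(a, s)\<leftarrow>kept. trie_blocks B (trie (slice E s l h)))"

text \<open>Constantly many blocks are set aside: the output buffer, one block for searching, and the
  cached boundary blocks (3 arrays, at most 2 atoms at each of the 3 dimensions).  The remaining
  memory is divided evenly among the 3 dimensions.\<close>

definition reserved_blocks :: nat where
  "reserved_blocks = 1 + 1 + 3 * 2 * 3"

definition dim_blocks :: "nat \<Rightarrow> nat \<Rightarrow> nat" where
  "dim_blocks M B = (M div B - reserved_blocks) div 3"

record run =
  reads :: nat
  results :: "(nat \<times> nat \<times> nat) list"
  has_spill :: bool

definition then_run :: "run \<Rightarrow> run \<Rightarrow> run" where
  "then_run r r' = \<lparr> reads = reads r + reads r', results = results r @ results r',
     has_spill = (has_spill r \<or> has_spill r') \<rparr>"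

text \<open>\<open>boxup E M B pass i mem l sp cache prov\<close> is BoxUp\<open>(i)\<close> from \<open>low[i] = l\<close> on, where
  \<^item> \<open>pass i u\<close> is how many of \<open>u\<close> unused blocks of dimension \<open>i\<close> are requested to be passed on to
    dimension \<open>i + 1\<close>,
  \<^item> \<open>mem\<close> is the memory of dimension \<open>i\<close> in blocks,
  \<^item> \<open>sp\<close> are the atoms spilled at the dimensions before \<open>i\<close>,
  \<^item> \<open>cache\<close> are the cached boundary blocks of the current pass,
  \<^item> \<open>prov\<close> are the slices provisioned at the dimensions before \<open>i\<close>.

  The result is \<^const>\<open>None\<close> if the execution does not terminate, or if an atom spills at its last
  variable, so that there is no further dimension to handle it.\<close>

partial_function (option) boxup ::
  "graph \<Rightarrow> nat \<Rightarrow> nat \<Rightarrow> (nat \<Rightarrow> nat \<Rightarrow> nat) \<Rightarrow> nat \<Rightarrow> nat \<Rightarrow> nat \<Rightarrow> item list \<Rightarrow>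
   (item \<Rightarrow> block set) \<Rightarrow> (atom \<Rightarrow> graph) \<Rightarrow> run option" where
  "boxup E M B pass i mem l sp cache prov =
     (let its = items_at i sp;
          b = mem div length its;
          spilled = spilled_items E B b l its;
          kept = kept_items E B b l its;
          h = high E B b l its;
          prov' = provision E l h kept prov;
          sp' = sp @ map (\<lambda>(a, s). (a, Some l)) spilled;
          unused = mem - used_blocks E B l h kept;
          this_step = \<lparr> reads = step_reads E B b l h its cache, results = [],
            has_spill = (spilled \<noteq> []) \<rparr>
      in if \<exists>(a, s)\<in>set spilled. s \<noteq> None then None
         else do {
           inner \<leftarrow>
             (if i < 3
              then boxup E M B pass (Suc i) (dim_blocks M B + min unused (pass i unused)) 0 sp'
                     (\<lambda>_. {}) prov'
              else Some \<lparr> reads = 0, results = lftj prov', has_spill = False \<rparr>);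
           if h = \<infinity> then Some (then_run this_step inner)
           else do {
             rest \<leftarrow> boxup E M B pass i mem (Suc (the_enat h)) sp
               (update_cache E B l h kept cache) prov;
             Some (then_run this_step (then_run inner rest))
           }
         })"

definition boxed_lftj :: "graph \<Rightarrow> nat \<Rightarrow> nat \<Rightarrow> (nat \<Rightarrow> nat \<Rightarrow> nat) \<Rightarrow> run option" where
  "boxed_lftj E M B pass = boxup E M B pass 1 (dim_blocks M B) 0 [] (\<lambda>_. {}) (\<lambda>_. {})"

text \<open>Every result tuple takes 3 words and is appended to the output through a one-block buffer.\<close>

definition io_count :: "nat \<Rightarrow> run \<Rightarrow> nat" where
  "io_count B r = reads r + nat \<lceil>3 * real (length (results r)) / real B\<rceil>"

end

theory Submission
  imports Defs
begin

text \<open>A step of dimension \<open>i\<close> with \<open>b\<close> blocks per atom reads \<open>O(b)\<close> blocks, because both the window of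
  the binary searches and a slice that fits into \<open>b\<close> blocks meet only \<open>O(b)\<close> blocks of the stored
  arrays.  Unless it is the last one, a step \<open>[l, h]\<close> covers much data: for some atom the slice
  \<open>[l, h + 1]\<close> does not fit, hence has \<open>\<Omega>(b B) = \<Omega>(M)\<close> tuples; this also holds for spilling steps,
  where \<open>h = l\<close>.  So a pass of a dimension has \<open>O(|E| / M)\<close> steps and reads \<open>O(|E| / B)\<close> blocks itself.
  Nesting three passes gives \<open>O(|E|^3 / (M^2 B))\<close>; without spills no atom is handled at the third
  dimension, which leaves two nested passes.  The boxes are disjoint, so every triangle is output at
  most once.\<close>

section \<open>Blocks touched by probes and slices\<close>

declare bsearch.simps [simp del]

section \<open>Sizes of tries, in tuples and in blocks\<close>

lemma finite_V1: "finite R \<Longrightarrow> finite (V1 R)"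
proof -
  assume "finite R"
  moreover have "V1 R = fst ` R" by (force simp: V1_def)
  ultimately show ?thesis by simp
qed

lemma finite_D: "finite R \<Longrightarrow> finite (D R v)"
proof -
  assume "finite R"
  moreover have "D R v \<subseteq> snd ` R" by (force simp: D_def)
  ultimately show ?thesis by (meson finite_imageI finite_subset)
qed

lemma card_eq_sum_D:
  assumes "finite R"
  shows "card R = (\<Sum>v\<in>V1 R. card (D R v))"
proof -
  have "R = Sigma (V1 R) (D R)" by (auto simp: V1_def D_def)
  then show ?thesis
    using assms by (metis card_SigmaI finite_V1 finite_D)
qed

lemma card_V1_le: "finite R \<Longrightarrow> card (V1 R) \<le> card R"
proof -
  assume "finite R"
  moreover have "V1 R = fst ` R" by (force simp: V1_def)
  ultimately show ?thesis by (simp add: card_image_le)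
qed

lemma length_val0_trie [simp]: "length (val0 (trie R)) = card (V1 R)"
  by (simp add: trie_def Let_def)

lemma length_idx0_trie [simp]: "length (idx0 (trie R)) = Suc (card (V1 R))"
  by (simp add: trie_def Let_def)

lemma length_val1_trie:
  assumes "finite R"
  shows "length (val1 (trie R)) = card R"
proof -
  have "length (val1 (trie R)) = (\<Sum>v\<leftarrow>sorted_list_of_set (V1 R). card (D R v))"
    by (simp add: trie_def Let_def length_concat o_def)
  also have "\<dots> = (\<Sum>v\<in>V1 R. card (D R v))"
    using finite_V1[OF assms] by (simp add: sum_list_distinct_conv_sum_set)
  finally show ?thesis
    using card_eq_sum_D[OF assms] by simp
qed

lemma trie_blocks_trie:
  assumes "finite R"
  shows "trie_blocks B (trie R) = nat \<lceil>real (card (V1 R)) / real B\<rceil>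
     + nat \<lceil>real (Suc (card (V1 R))) / real B\<rceil> + nat \<lceil>real (card R) / real B\<rceil>"
  using length_val1_trie[OF assms] by (simp add: trie_blocks_def)

lemma trie_blocks_mono:
  assumes "R \<subseteq> S" "finite S"
  shows "trie_blocks B (trie R) \<le> trie_blocks B (trie S)"
proof -
  have fin: "finite R" using assms finite_subset by auto
  have "V1 R \<subseteq> V1 S" using assms by (auto simp: V1_def)
  then have 1: "card (V1 R) \<le> card (V1 S)"
    using assms finite_V1 card_mono by blast
  have 2: "card R \<le> card S" using assms card_mono by blast
  show ?thesis
    unfolding trie_blocks_trie[OF fin] trie_blocks_trie[OF assms(2)]
    using 1 2 by (intro add_mono nat_mono ceiling_mono divide_right_mono) auto
qed

text \<open>With n first values and m tuples the three arrays have n, n + 1 and m entries, together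
  at most 4 m if m is positive, and rounding up adds less than one block for each array. So
  overflowing \<open>b\<close> blocks forces a number of tuples proportional to
  \<open>b * B\<close>. This is the source of progress.\<close>

lemma card_ge_of_trie_blocks_gt:
  assumes "finite R" "B > 0" "b \<ge> 6" "trie_blocks B (trie R) > b"
  shows "real b * real B / 6 \<le> real (card R)"
proof -
  let ?n = "card (V1 R)" and ?m = "card R"
  have up: "real (nat \<lceil>x\<rceil>) < x + 1" if "x \<ge> 0" for x :: real
    using that by linarith
  have le: "?n \<le> ?m" using card_V1_le assms(1) .
  \<comment> \<open>The trie of the empty relation holds only the sentinel index entry, hence a
    single block. A nonempty relation lets m absorb the sentinel.\<close>
  have "?m \<noteq> 0"
  proof
    assume "?m = 0"
    then have "R = {}" using assms(1) by simp
    then have "trie_blocks B (trie R) = nat \<lceil>1 / real B\<rceil>"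
      by (simp add: trie_blocks_trie V1_def)
    also have "\<dots> \<le> 1" using assms(2) by (simp add: ceiling_le_iff)
    finally show False using assms by simp
  qed
  then have m1: "?m \<ge> 1" by simp
  have "real b + 1 \<le> real (trie_blocks B (trie R))" using assms(4) by simp
  also have "\<dots> \<le> real ?n / real B + real (Suc ?n) / real B + real ?m / real B + 3"
    unfolding trie_blocks_trie[OF assms(1)]
    using up[of "real ?n / real B"] up[of "real (Suc ?n) / real B"] up[of "real ?m / real B"]
    by simp
  also have "\<dots> = (2 * real ?n + 1 + real ?m) / real B + 3" by (simp add: add_divide_distrib)
  also have "\<dots> \<le> 4 * real ?m / real B + 3"
    using le m1 by (intro add_right_mono divide_right_mono) auto
  finally have "real b - 2 \<le> 4 * real ?m / real B" by simp
  then have "(real b - 2) * real B \<le> 4 * real ?m" using assms(2) by (simp add: field_simps)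
  \<comment> \<open>From b >= 6 follows b - 2 >= 2 b / 3; dividing by 4 gives the constant
    6.\<close>
  moreover have "2/3 * real b * real B \<le> (real b - 2) * real B"
    using assms(3) by (intro mult_right_mono) auto
  ultimately show ?thesis by simp
qed

section \<open>Blocks met by ranges of positions and by searches\<close>

lemma card_div_image_interval:
  fixes A :: "nat set"
  assumes "A \<subseteq> {p..<p + n}" "B > 0"
  shows "card ((\<lambda>q. q div B) ` A) \<le> Suc (nat \<lceil>real n / real B\<rceil>)"
proof -
  let ?c = "nat \<lceil>real n / real B\<rceil>"
  have "real n / real B \<le> real ?c" by linarith
  then have "real n \<le> real ?c * real B"
    using assms(2) pos_divide_le_eq[of "real B" "real n" "real ?c"] by simp
  then have "real n \<le> real (?c * B)" unfolding of_nat_mult .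
  then have n: "n \<le> ?c * B" by linarith
  have "q div B \<in> {p div B..p div B + ?c}" if "q \<in> A" for q
  proof -
    have q: "p \<le> q" "q < p + n" using assms(1) that by auto
    have "q div B \<le> (p + ?c * B) div B" using q n by (intro div_le_mono) auto
    also have "\<dots> = p div B + ?c" using assms(2) by simp
    finally show ?thesis using q by (simp add: div_le_mono)
  qed
  then have "card ((\<lambda>q. q div B) ` A) \<le> card {p div B..p div B + ?c}"
    by (intro card_mono) auto
  then show ?thesis by simp
qed

text \<open>The range need not start at a block boundary, which costs one block more than the
  rounded-up length.\<close>

lemma card_block_image_interval:
  fixes A :: "nat set" and t :: array
  assumes "A \<subseteq> {p..<p + n}" "B > 0"
  shows "card ((\<lambda>q. (t, q div B)) ` A) \<le> Suc (nat \<lceil>real n / real B\<rceil>)"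
proof -
  have "(\<lambda>q. (t, q div B)) ` A = Pair t ` (\<lambda>q. q div B) ` A" by auto
  then have "card ((\<lambda>q. (t, q div B)) ` A) = card ((\<lambda>q. q div B) ` A)"
    by (simp add: card_image inj_on_def)
  then show ?thesis using card_div_image_interval[OF assms] by simp
qed

lemma set_bsearch_subset: "set (bsearch P lo hi) \<subseteq> {lo..<hi}"
proof (induction P lo hi rule: bsearch.induct)
  case (1 P lo hi)
  show ?case
  proof (cases "lo < hi")
    case True
    define m where "m = (lo + hi) div 2"
    have m: "lo \<le> m" "m < hi" using True by (auto simp: m_def)
    have "set (bsearch P (Suc m) hi) \<subseteq> {Suc m..<hi}" if "P m"
      using 1(1)[OF True m_def that] .
    moreover have "set (bsearch P lo m) \<subseteq> {lo..<m}" if "\<not> P m"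
      using 1(2)[OF True m_def that] .
    moreover have "set (bsearch P lo hi)
        = insert m (set (if P m then bsearch P (Suc m) hi else bsearch P lo m))"
      using True by (subst bsearch.simps) (simp add: Let_def m_def)
    ultimately show ?thesis
      using m by (cases "P m") fastforce+
  qed (simp add: bsearch.simps)
qed

text \<open>It does not matter which positions the search inspects: the whole window of
  \<open>b * B\<close> positions meets at most \<open>b + 1\<close> blocks, so no logarithm enters
  the count.\<close>

lemma card_entry_block_bsearch:
  assumes "B > 0"
  shows "card (entry_block B s ` set (bsearch P (pos R s l) (window_end R B s l b))) \<le> Suc b"
proof -
  have sub: "set (bsearch P (pos R s l) (window_end R B s l b)) \<subseteq> {pos R s l..<pos R s l + b * B}"
    using set_bsearch_subset[of P "pos R s l" "window_end R B s l b"]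
    by (force simp: window_end_def)
  have "entry_block B s = (\<lambda>q. (case s of None \<Rightarrow> Val0 | Some _ \<Rightarrow> Val1, q div B))"
    by (auto simp: entry_block_def split: option.splits)
  then show ?thesis
    using card_block_image_interval[OF sub assms] assms by simp
qed

lemma card_locate_blocks_le: "B > 0 \<Longrightarrow> card (locate_blocks R B s l b h) \<le> Suc b"
  unfolding locate_blocks_def by (rule card_entry_block_bsearch)

text \<open>At most b + 1 value blocks and b + 3 index blocks. For the empty start tuple the index
  positions are the first of the window and the successors of inspected ones, all in a range of
  length b B + 1; for a unary one there are only two.\<close>

lemma card_probe_blocks_le:
  assumes "B > 0"
  shows "card (probe_blocks R B s l b) \<le> 2 * b + 4"
proof -
  define ms where "ms = set (bsearch (\<lambda>m. fits R B s l b (enat (entry R s m)))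
                      (pos R s l) (window_end R B s l b))"
  define I where "I = (case s of None \<Rightarrow> insert (pos R s l) (Suc ` ms) | Some v \<Rightarrow> {row R v, Suc (row R v)})"
  have e: "card (entry_block B s ` ms) \<le> Suc b"
    unfolding ms_def by (rule card_entry_block_bsearch[OF assms])
  have i: "card ((\<lambda>q. (Idx0, q div B)) ` I) \<le> b + 3"
  proof (cases s)
    case None
    have "ms \<subseteq> {pos R s l..<pos R s l + b * B}"
      using set_bsearch_subset unfolding ms_def window_end_def by fastforce
    then have "I \<subseteq> {pos R s l..<pos R s l + Suc (b * B)}"
      using None by (auto simp: I_def)
    then have "card ((\<lambda>q. (Idx0, q div B)) ` I) \<le> Suc (nat \<lceil>real (Suc (b * B)) / real B\<rceil>)"
      by (rule card_block_image_interval[OF _ assms])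
    also have "real (Suc (b * B)) / real B \<le> real (Suc b)"
      using assms by (simp add: field_simps)
    then have "nat \<lceil>real (Suc (b * B)) / real B\<rceil> \<le> Suc b"
      by (simp add: ceiling_le_iff nat_le_iff)
    finally show ?thesis by simp
  next
    case (Some v)
    then show ?thesis by (simp add: I_def card_insert_if)
  qed
  have "probe_blocks R B s l b = entry_block B s ` ms \<union> (\<lambda>q. (Idx0, q div B)) ` I"
    unfolding probe_blocks_def Let_def I_def ms_def by (rule refl)
  then have "card (probe_blocks R B s l b)
      \<le> card (entry_block B s ` ms) + card ((\<lambda>q. (Idx0, q div B)) ` I)"
    by (metis card_Un_le)
  then show ?thesis using e i by simp
qed

section \<open>Slices and probes\<close>

lemma slice_subset: "slice R s l h \<subseteq> R"
  by (auto simp: slice_def split: option.splits)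

lemma finite_slice: "finite R \<Longrightarrow> finite (slice R s l h)"
  by (rule finite_subset[OF slice_subset])

lemma slice_mono: "h \<le> h' \<Longrightarrow> slice R s l h \<subseteq> slice R s l h'"
  by (auto simp: slice_def split: option.splits)

lemma fits_mono:
  assumes "finite R" "fits R B s l b h'" "h \<le> h'"
  shows "fits R B s l b h"
  using assms trie_blocks_mono[OF slice_mono[OF assms(3)] finite_slice[OF assms(1)]]
  unfolding fits_def by (meson le_trans)

text \<open>A finite relation has a largest value, and all upper bounds from there on give the same
  slice.\<close>

lemma slice_infinity_eq:
  assumes "finite R"
  shows "\<exists>m. slice R s l \<infinity> = slice R s l (enat m)"
proof -
  obtain m where m: "\<forall>v\<in>fst ` R \<union> snd ` R. v \<le> m"
    using assms by (meson finite_UnI finite_imageI finite_nat_set_iff_bounded_le)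
  then have "t0 \<le> m" "t1 \<le> m" if "(t0, t1) \<in> R" for t0 t1
    using that by force+
  then have "slice R s l \<infinity> = slice R s l (enat m)"
    by (auto simp: slice_def split: option.splits)
  then show ?thesis ..
qed

text \<open>\<open>GREATEST\<close> is informative only if a maximum exists. Either \<infinity> fits
  and is the maximum, or no bound from some finite m on fits, and the candidates form a finite
  nonempty set.\<close>

lemma probe_SomeD:
  assumes "finite R" "probe R B s l b = Some h"
  shows "enat l \<le> h" "fits R B s l b h" "\<And>h'. enat l \<le> h' \<Longrightarrow> fits R B s l b h' \<Longrightarrow> h' \<le> h"
proof -
  let ?P = "\<lambda>h. enat l \<le> h \<and> fits R B s l b h"
  have ex: "\<exists>h. ?P h" and h: "h = (GREATEST h. ?P h)"
    using assms(2) by (auto simp: probe_def split: if_splits)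
  have "\<exists>g. ?P g \<and> (\<forall>y. ?P y \<longrightarrow> y \<le> g)"
  proof (cases "fits R B s l b \<infinity>")
    case True
    then show ?thesis by (intro exI[of _ \<infinity>]) simp
  next
    case False
    obtain m where m: "slice R s l \<infinity> = slice R s l (enat m)"
      using slice_infinity_eq[OF assms(1)] by blast
    have bd: "y \<le> enat m" if "?P y" for y
      using that False m fits_mono[OF assms(1), of B s l b y "enat m"]
      by (metis fits_def linear)
    have "{y. ?P y} \<subseteq> enat ` {..m}"
    proof
      fix y assume "y \<in> {y. ?P y}"
      then have "y \<le> enat m" using bd by simp
      then show "y \<in> enat ` {..m}" by (cases y) auto
    qed
    then have fin: "finite {y. ?P y}" by (meson finite_atMost finite_imageI finite_subset)
    then have "Max {y. ?P y} \<in> {y. ?P y}" using ex by (intro Max_in) auto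
    then show ?thesis using fin by (intro exI[of _ "Max {y. ?P y}"]) auto
  qed
  then obtain g where g: "?P g" "\<And>y. ?P y \<Longrightarrow> y \<le> g" by blast
  then have "h = g" unfolding h by (intro Greatest_equality) auto
  with g show "enat l \<le> h" "fits R B s l b h"
    "\<And>h'. enat l \<le> h' \<Longrightarrow> fits R B s l b h' \<Longrightarrow> h' \<le> h" by auto
qed

lemma probe_NoneD: "probe R B s l b = None \<Longrightarrow> enat l \<le> h \<Longrightarrow> \<not> fits R B s l b h"
  by (auto simp: probe_def split: if_splits)

text \<open>Below a fixed first value, the slice for the single second value \<open>l\<close> has at
  most one tuple, so its arrays with 1, 2 and 1 entries need at most 4 blocks even for B = 1. Hence
  an atom spills at most at its first variable, and the failure case of \<open>boxup\<close> never
  occurs.\<close>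

lemma probe_start_value:
  assumes "finite R" "B > 0" "b \<ge> 4"
  shows "probe R B (Some v) l b \<noteq> None"
proof -
  let ?S = "slice R (Some v) l (enat l)"
  have "?S \<subseteq> {(v, l)}" by (auto simp: slice_def)
  then have "card ?S \<le> 1" using card_mono[of "{(v, l)}" ?S] by simp
  moreover have "card (V1 ?S) \<le> card ?S" by (rule card_V1_le[OF finite_slice[OF assms(1)]])
  ultimately have "real (card ?S) / B \<le> 1" "real (card (V1 ?S)) / B \<le> 1"
    "real (Suc (card (V1 ?S))) / B \<le> 2"
    using assms(2) by (auto simp: divide_le_eq)
  then have "trie_blocks B (trie ?S) \<le> 1 + 2 + 1"
    unfolding trie_blocks_trie[OF finite_slice[OF assms(1)]]
    by (intro add_mono) (auto simp: nat_le_iff ceiling_le_iff)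
  then have "fits R B (Some v) l b (enat l)" using assms(3) by (simp add: fits_def)
  then show ?thesis using probe_NoneD by blast
qed

lemma card_slice_add:
  assumes "finite R" "l \<le> Suc h"
  shows "card (slice R s l (enat h)) + card (slice R s (Suc h) \<infinity>) = card (slice R s l \<infinity>)"
proof -
  have "slice R s l \<infinity> = slice R s l (enat h) \<union> slice R s (Suc h) \<infinity>"
    using assms(2) by (auto simp: slice_def split: option.splits)
  moreover have "slice R s l (enat h) \<inter> slice R s (Suc h) \<infinity> = {}"
    by (auto simp: slice_def split: option.splits)
  ultimately show ?thesis
    using finite_slice[OF assms(1)] by (simp add: card_Un_disjoint)
qed

lemma card_slice_le: "finite R \<Longrightarrow> card (slice R s l h) \<le> card R"
  by (rule card_mono[OF _ slice_subset])

section \<open>Contiguity of slices in the stored arrays\<close>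

lemma nth_concat_map:
  assumes "j < length vs" "k < length (f (vs ! j))"
  shows "concat (map f vs) ! ((\<Sum>v\<leftarrow>take j vs. length (f v)) + k) = f (vs ! j) ! k"
proof -
  have "vs = take j vs @ vs ! j # drop (Suc j) vs" using assms(1) by (simp add: id_take_nth_drop)
  then have "concat (map f vs) = concat (map f (take j vs)) @ f (vs ! j) @ concat (map f (drop (Suc j) vs))"
    by (metis concat.simps(2) concat_append list.simps(9) map_append)
  moreover have "length (concat (map f (take j vs))) = (\<Sum>v\<leftarrow>take j vs. length (f v))"
    by (simp add: length_concat o_def)
  ultimately show ?thesis using assms(2) by (simp add: nth_append)
qed

lemma idx0_nth:
  "j \<le> card (V1 R) \<Longrightarrow> idx0 (trie R) ! j
     = (\<Sum>v\<leftarrow>take j (sorted_list_of_set (V1 R)). card (D R v))"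
  by (simp add: trie_def Let_def nth_append del: upt_Suc)

lemma val0_nth: "val0 (trie R) = sorted_list_of_set (V1 R)"
  by (simp add: trie_def Let_def)

lemma idx0_Suc:
  assumes "j < card (V1 R)"
  shows "idx0 (trie R) ! Suc j = idx0 (trie R) ! j + card (D R (val0 (trie R) ! j))"
  using assms by (simp add: idx0_nth val0_nth take_Suc_conv_app_nth)

lemma val1_nth:
  assumes "j < card (V1 R)" "k < card (D R (val0 (trie R) ! j))"
  shows "val1 (trie R) ! (idx0 (trie R) ! j + k) = sorted_list_of_set (D R (val0 (trie R) ! j)) ! k"
proof -
  have "val1 (trie R) = concat (map (\<lambda>v. sorted_list_of_set (D R v)) (sorted_list_of_set (V1 R)))"
    by (simp add: trie_def Let_def)
  then show ?thesis
    using assms nth_concat_map[of j "sorted_list_of_set (V1 R)" k "\<lambda>v. sorted_list_of_set (D R v)"]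
    by (simp add: idx0_nth val0_nth)
qed

lemma idx0_add_sum:
  assumes "p + n \<le> card (V1 R)"
  shows "idx0 (trie R) ! (p + n) = idx0 (trie R) ! p + (\<Sum>j=p..<p + n. card (D R (val0 (trie R) ! j)))"
  using assms by (induction n) (auto simp: idx0_Suc)

text \<open>By monotonicity every position between the least and the greatest qualifying one
  qualifies too.\<close>

lemma sorted_nth_range:
  fixes xs :: "nat list"
  assumes "sorted_wrt (<) xs"
  shows "\<exists>p n. p + n \<le> length xs
     \<and> {j. j < length xs \<and> l \<le> xs ! j \<and> enat (xs ! j) \<le> h} = {p..<p + n}"
proof -
  let ?A = "{j. j < length xs \<and> l \<le> xs ! j \<and> enat (xs ! j) \<le> h}"
  show ?thesis
  proof (cases "?A = {}")
    case True
    then show ?thesis by (intro exI[of _ 0]) auto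
  next
    case False
    have fin: "finite ?A" by simp
    have mn: "Min ?A \<in> ?A" and mx: "Max ?A \<in> ?A" using Min_in[OF fin False] Max_in[OF fin False] by auto
    have mono: "xs ! i \<le> xs ! j" if "i \<le> j" "j < length xs" for i j
      using sorted_wrt_nth_less[OF assms, of i j] that by (cases "i = j") auto
    have eq: "?A = {Min ?A..<Suc (Max ?A)}"
    proof (intro equalityI subsetI)
      fix j assume "j \<in> ?A"
      then show "j \<in> {Min ?A..<Suc (Max ?A)}" using fin by (simp add: less_Suc_eq_le)
    next
      fix j assume "j \<in> {Min ?A..<Suc (Max ?A)}"
      then have j: "Min ?A \<le> j" "j \<le> Max ?A" by auto
      have le: "xs ! Min ?A \<le> xs ! j" "xs ! j \<le> xs ! Max ?A" "j < length xs" using j mx mono by auto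
      have bd: "l \<le> xs ! Min ?A" "enat (xs ! Max ?A) \<le> h" using mn mx by auto
      have "l \<le> xs ! j" using bd(1) le(1) by (rule order_trans)
      moreover have "enat (xs ! j) \<le> h" using le(2) by (intro order_trans[OF _ bd(2)]) simp
      ultimately show "j \<in> ?A" using le(3) by simp
    qed
    have n: "Min ?A + (Suc (Max ?A) - Min ?A) = Suc (Max ?A)"
      using le_SucI[OF Max_ge[OF fin mn]] by (rule le_add_diff_inverse)
    have "Suc (Max ?A) \<le> length xs" using mx by simp
    then show ?thesis
      using eq by (intro exI[of _ "Min ?A"] exI[of _ "Suc (Max ?A) - Min ?A"]) (unfold n, rule conjI)
  qed
qed

lemma sorted_list_nth_range:
  fixes A :: "nat set"
  assumes "finite A"
  defines "xs \<equiv> sorted_list_of_set A"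
  shows "\<exists>p n. {j. j < card A \<and> l \<le> xs ! j \<and> enat (xs ! j) \<le> h} = {p..<p + n} \<and> p + n \<le> card A
    \<and> (!) xs ` {p..<p + n} = {u \<in> A. l \<le> u \<and> enat u \<le> h}
    \<and> n = card {u \<in> A. l \<le> u \<and> enat u \<le> h} \<and> inj_on ((!) xs) {p..<p + n}"
proof -
  have len: "length xs = card A" and set: "set xs = A" and dist: "distinct xs"
    using assms by auto
  obtain p n where pn: "p + n \<le> card A" "{j. j < card A \<and> l \<le> xs ! j \<and> enat (xs ! j) \<le> h} = {p..<p + n}"
    using sorted_nth_range[of xs l h] len by (auto simp: xs_def)
  have inj: "inj_on ((!) xs) {p..<p + n}"
    using dist len pn(1) by (auto simp: inj_on_def nth_eq_iff_index_eq)
  have im: "(!) xs ` {p..<p + n} = {u \<in> A. l \<le> u \<and> enat u \<le> h}"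
  proof -
    have A: "A = (!) xs ` {j. j < card A}" using set len by (auto simp: set_conv_nth)
    have "{u \<in> A. l \<le> u \<and> enat u \<le> h} = {u \<in> (!) xs ` {j. j < card A}. l \<le> u \<and> enat u \<le> h}"
      using A by simp
    also have "\<dots> = (!) xs ` {j. j < card A \<and> l \<le> xs ! j \<and> enat (xs ! j) \<le> h}" by auto
    finally show ?thesis using pn(2) by simp
  qed
  have "n = card ((!) xs ` {p..<p + n})" using inj by (simp add: card_image)
  then show ?thesis using pn inj im by metis
qed

text \<open>With an empty start tuple the first values of the slice form a range of rows, and the
  sum of their child counts telescopes along the index array to \<open>card S\<close>. With a start
  value there is a single row, and the cells are a range within its sorted children.\<close>

lemma slice_positions:
  fixes R :: graph and s :: start and l :: nat and h :: enat
  assumes "finite R"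
  defines "S \<equiv> slice R s l h"
  shows "\<exists>p q. slice_rows R S \<subseteq> {p..<p + card (V1 S)} \<and> slice_cells R S \<subseteq> {q..<q + card S}"
proof (cases s)
  case None
  have V: "V1 S = {u \<in> V1 R. l \<le> u \<and> enat u \<le> h}"
    using None by (auto simp: S_def slice_def V1_def)
  obtain p n where p: "{j. j < card (V1 R) \<and> l \<le> val0 (trie R) ! j \<and> enat (val0 (trie R) ! j) \<le> h} = {p..<p + n}"
      "p + n \<le> card (V1 R)" "(!) (val0 (trie R)) ` {p..<p + n} = V1 S"
      "n = card (V1 S)" "inj_on ((!) (val0 (trie R))) {p..<p + n}"
    using sorted_list_nth_range[OF finite_V1[OF assms(1)], of l h] unfolding val0_nth V by blast
  have sub: "slice_rows R S \<subseteq> {p..<p + n}"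
  proof
    fix j assume "j \<in> slice_rows R S"
    then show "j \<in> {p..<p + n}" unfolding p(1)[symmetric] by (auto simp: slice_rows_def V)
  qed
  have mono: "idx0 (trie R) ! i \<le> idx0 (trie R) ! j" if "i \<le> j" "j \<le> card (V1 R)" for i j
    using idx0_add_sum[of i "j - i" R] that by simp
  \<comment> \<open>An empty start tuple restricts the first column only, so a surviving value keeps
    all its children.\<close>
  have D: "D S v = D R v" if "v \<in> V1 S" for v
    using that None by (auto simp: S_def D_def slice_def V1_def)
  have "card S = (\<Sum>v\<in>V1 S. card (D S v))"
    using card_eq_sum_D finite_slice[OF assms(1)] unfolding S_def by blast
  also have "\<dots> = (\<Sum>v\<in>V1 S. card (D R v))" using D by simp
  also have "\<dots> = (\<Sum>j=p..<p + n. card (D R (val0 (trie R) ! j)))"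
    unfolding p(3)[symmetric] using p(5) by (simp add: sum.reindex o_def)
  finally have c: "idx0 (trie R) ! (p + n) = idx0 (trie R) ! p + card S"
    using idx0_add_sum[OF p(2)] by simp
  have "slice_cells R S \<subseteq> {idx0 (trie R) ! p..<idx0 (trie R) ! (p + n)}"
  proof
    fix q assume "q \<in> slice_cells R S"
    then obtain j where j: "j \<in> slice_rows R S" "idx0 (trie R) ! j \<le> q" "q < idx0 (trie R) ! Suc j"
      by (auto simp: slice_cells_def)
    then have "p \<le> j" "j < p + n" using sub by auto
    then have "idx0 (trie R) ! p \<le> idx0 (trie R) ! j" "idx0 (trie R) ! Suc j \<le> idx0 (trie R) ! (p + n)"
      using mono p(2) by auto
    then show "q \<in> {idx0 (trie R) ! p..<idx0 (trie R) ! (p + n)}" using j by simp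
  qed
  then show ?thesis using sub c p(4) by metis
next
  case (Some v)
  show ?thesis
  proof (cases "S = {}")
    case True
    then show ?thesis by (auto simp: slice_rows_def slice_cells_def V1_def)
  next
    case False
    have V: "V1 S = {v}" using False Some by (auto simp: S_def slice_def V1_def)
    then have "v \<in> V1 R" using slice_subset[of R s l h] by (force simp: S_def V1_def)
    then obtain j where j: "j < card (V1 R)" "val0 (trie R) ! j = v"
      using finite_V1[OF assms(1)] unfolding val0_nth
      by (metis in_set_conv_nth sorted_list_of_set.length_sorted_key_list_of_set set_sorted_list_of_set)
    have "distinct (val0 (trie R))" by (simp add: val0_nth)
    then have rows: "slice_rows R S = {j}"
      using j by (auto simp: slice_rows_def V distinct_conv_nth)
    define xs where "xs = sorted_list_of_set (D R v)"
    obtain p n where p: "{k. k < card (D R v) \<and> l \<le> xs ! k \<and> enat (xs ! k) \<le> h} = {p..<p + n}"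
        "n = card {u \<in> D R v. l \<le> u \<and> enat u \<le> h}"
      using sorted_list_nth_range[OF finite_D[OF assms(1)], of v l h] unfolding xs_def by blast
    have "S = Pair v ` {u \<in> D R v. l \<le> u \<and> enat u \<le> h}"
      using Some by (auto simp: S_def slice_def D_def)
    then have n: "n = card S" using p(2) by (simp add: card_image inj_on_def)
    have "slice_cells R S \<subseteq> {idx0 (trie R) ! j + p..<idx0 (trie R) ! j + p + card S}"
    proof
      fix q assume "q \<in> slice_cells R S"
      then have q: "idx0 (trie R) ! j \<le> q" "q < idx0 (trie R) ! Suc j" "(v, val1 (trie R) ! q) \<in> S"
        using rows j(2) by (auto simp: slice_cells_def)
      \<comment> \<open>The offset within the child range of \<open>v\<close> is the position in its
        sorted list of children.\<close>
      define k where "k = q - idx0 (trie R) ! j"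
      have k: "q = idx0 (trie R) ! j + k" "k < card (D R v)"
        using q idx0_Suc[OF j(1)] j(2) by (auto simp: k_def)
      have "val1 (trie R) ! q = xs ! k"
        using val1_nth[OF j(1), of k] k j(2) by (simp add: xs_def)
      then have "l \<le> xs ! k" "enat (xs ! k) \<le> h" using q(3) Some by (auto simp: S_def slice_def)
      then have "k \<in> {p..<p + n}" unfolding p(1)[symmetric] using k by simp
      then show "q \<in> {idx0 (trie R) ! j + p..<idx0 (trie R) ! j + p + card S}" using k n by simp
    qed
    moreover have "slice_rows R S \<subseteq> {j..<j + card (V1 S)}" using rows V by simp
    ultimately show ?thesis by blast
  qed
qed

text \<open>Makes \<open>card\<close> monotone when the cached blocks are removed from the
  count.\<close>

lemma finite_slice_blocks:
  assumes "finite R"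
  shows "finite (slice_blocks R B (slice R s l h))"
proof -
  have "finite (slice_rows R (slice R s l h))" "finite (slice_cells R (slice R s l h))"
    using slice_positions[OF assms, of s l h] finite_subset[OF _ finite_atLeastLessThan] by blast+
  then show ?thesis by (simp add: slice_blocks_def)
qed

text \<open>The copy of each array starts at a block boundary, whereas the original range may
  straddle one more block; three arrays give the summand 3.\<close>

lemma card_slice_blocks_le:
  assumes "finite R" "B > 0"
  shows "card (slice_blocks R B (slice R s l h)) \<le> trie_blocks B (trie (slice R s l h)) + 3"
proof -
  define S where "S = slice R s l h"
  have fin: "finite S" unfolding S_def using assms(1) by (rule finite_slice)
  obtain p q where pq: "slice_rows R S \<subseteq> {p..<p + card (V1 S)}" "slice_cells R S \<subseteq> {q..<q + card S}"
    using slice_positions[OF assms(1)] unfolding S_def by blast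
  have "slice_rows R S \<union> Suc ` slice_rows R S \<subseteq> {p..<p + Suc (card (V1 S))}" using pq(1) by auto
  then have "card ((\<lambda>j. (Val0, j div B)) ` slice_rows R S)
     + card ((\<lambda>j. (Idx0, j div B)) ` (slice_rows R S \<union> Suc ` slice_rows R S))
     + card ((\<lambda>q. (Val1, q div B)) ` slice_cells R S) \<le> trie_blocks B (trie S) + 3"
    using card_block_image_interval[OF pq(1) assms(2), of Val0]
      card_block_image_interval[OF pq(2) assms(2), of Val1]
      card_block_image_interval[of "slice_rows R S \<union> Suc ` slice_rows R S" p "Suc (card (V1 S))" B Idx0] assms(2)
    unfolding trie_blocks_trie[OF fin] by linarith
  moreover have "card (slice_blocks R B S) \<le> card ((\<lambda>j. (Val0, j div B)) ` slice_rows R S)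
     + card ((\<lambda>j. (Idx0, j div B)) ` (slice_rows R S \<union> Suc ` slice_rows R S))
     + card ((\<lambda>q. (Val1, q div B)) ` slice_cells R S)"
    unfolding slice_blocks_def by (meson card_Un_le order_trans add_right_mono)
  ultimately show ?thesis unfolding S_def by linarith
qed

section \<open>Cost and progress of a step\<close>

text \<open>Without spills, \<open>high\<close> is the infimum of a finite nonempty set, hence one
  of its elements.\<close>

lemma high_attained:
  assumes "its \<noteq> []" "spilled_items E B b l its = []"
  shows "\<exists>(a, s)\<in>set its. probe E B s l b = Some (high E B b l its)"
proof -
  let ?P = "(\<lambda>(a, s). the (probe E B s l b)) ` set its"
  have "Inf ?P = Min ?P" using assms(1) by (intro cInf_eq_Min) auto
  then have "Inf ?P \<in> ?P" using assms(1) by (metis (no_types, lifting) Min_in finite_imageI finite_set image_is_empty set_empty)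
  then obtain a s where as: "(a, s) \<in> set its" "Inf ?P = the (probe E B s l b)" by auto
  moreover have "probe E B s l b \<noteq> None"
    using as(1) assms(2) by (auto simp: spilled_items_def filter_empty_conv)
  ultimately show ?thesis using assms(2) by (auto simp: high_def)
qed

text \<open>In a spilling step \<open>high\<close> drops to \<open>l\<close>, and a successful probe
  never returns less than that.\<close>

lemma high_le_probe:
  assumes "finite E" "(a, s) \<in> set (kept_items E B b l its)" "probe E B s l b = Some h"
  shows "high E B b l its \<le> h"
proof (cases "spilled_items E B b l its = []")
  case True
  have "(a, s) \<in> set its" using assms(2) by (auto simp: kept_items_def)
  then have "the (probe E B s l b) \<in> (\<lambda>(a, s). the (probe E B s l b)) ` set its" by force
  then show ?thesis using True assms(3) by (auto simp: high_def intro: Inf_lower)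
next
  case False
  then show ?thesis using probe_SomeD(1)[OF assms(1,3)] by (simp add: high_def)
qed

lemma low_le_high:
  assumes "finite E"
  shows "enat l \<le> high E B b l its"
proof (cases "its = [] \<or> spilled_items E B b l its \<noteq> []")
  case True
  then show ?thesis by (auto simp: high_def spilled_items_def top_enat_def)
next
  case False
  then obtain s where "probe E B s l b = Some (high E B b l its)"
    using high_attained by blast
  then show ?thesis using probe_SomeD(1)[OF assms] by blast
qed

text \<open>Although \<open>high\<close> may stem from another item, lowering an upper bound only
  shrinks the slice.\<close>

lemma kept_fits:
  assumes "finite E" "(a, s) \<in> set (kept_items E B b l its)"
  shows "fits E B s l b (high E B b l its)"
proof -
  obtain h where h: "probe E B s l b = Some h" using assms(2) by (auto simp: kept_items_def)
  then show ?thesis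
    using probe_SomeD(2)[OF assms(1) h] high_le_probe[OF assms h] fits_mono[OF assms(1)] by blast
qed

text \<open>The slice of some item cannot be extended by one value: it is too large already
  (spill), or its probe returned the minimal upper bound.\<close>

lemma high_maximal:
  assumes "finite E" "its \<noteq> []" "high E B b l its = enat h"
  shows "\<exists>(a, s)\<in>set its. \<not> fits E B s l b (enat (Suc h))"
proof (cases "spilled_items E B b l its = []")
  case True
  then obtain a s where as: "(a, s) \<in> set its" "probe E B s l b = Some (enat h)"
    using high_attained[OF assms(2) True, unfolded assms(3)] by blast
  have "enat l \<le> enat h" using probe_SomeD(1)[OF assms(1) as(2)] .
  then have "\<not> fits E B s l b (enat (Suc h))"
    using probe_SomeD(3)[OF assms(1) as(2), of "enat (Suc h)"] by auto
  then show ?thesis using as by blast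
next
  case False
  then obtain a s where as: "(a, s) \<in> set its" "probe E B s l b = None"
    by (auto simp: spilled_items_def filter_empty_conv)
  have "h = l" using False assms(3) by (simp add: high_def)
  then have "\<not> fits E B s l b (enat (Suc h))" using probe_NoneD[OF as(2)] by simp
  then show ?thesis using as(1) by blast
qed

text \<open>Each item costs at most 2 b + 4 blocks for probing, and a kept one at most (b + 1) + (b
  + 3) for locating the end and copying. The cache only removes blocks, so its content is arbitrary.
  Finally 4 b + 8 <= 6 b.\<close>

lemma step_reads_le:
  assumes "finite E" "B > 0" "b \<ge> 6"
  shows "step_reads E B b l (high E B b l its) its cache \<le> 6 * b * length its"
proof -
  let ?h = "high E B b l its" and ?k = "kept_items E B b l its"
  have kept: "card (locate_blocks E B s l b ?h) + card (slice_blocks E B (slice E s l ?h) - cache (a, s))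
      \<le> 2 * b + 4" if "(a, s) \<in> set ?k" for a s
  proof -
    have "card (slice_blocks E B (slice E s l ?h) - cache (a, s)) \<le> card (slice_blocks E B (slice E s l ?h))"
      using finite_slice_blocks[OF assms(1)] by (intro card_mono) auto
    moreover have "trie_blocks B (trie (slice E s l ?h)) \<le> b"
      using kept_fits[OF assms(1) that] by (simp add: fits_def)
    ultimately show ?thesis
      using card_slice_blocks_le[OF assms(1,2), of s l ?h] card_locate_blocks_le[OF assms(2), of E s l b ?h]
      by linarith
  qed
  have "(\<Sum>(a, s)\<leftarrow>?k. card (locate_blocks E B s l b ?h)
      + card (slice_blocks E B (slice E s l ?h) - cache (a, s))) \<le> (\<Sum>x\<leftarrow>?k. 2 * b + 4)"
    using kept by (intro sum_list_mono) auto
  also have "\<dots> \<le> (\<Sum>x\<leftarrow>its. 2 * b + 4)"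
    unfolding kept_items_def by (simp add: sum_list_triv)
  finally have 1: "(\<Sum>(a, s)\<leftarrow>?k. card (locate_blocks E B s l b ?h)
      + card (slice_blocks E B (slice E s l ?h) - cache (a, s))) \<le> length its * (2 * b + 4)"
    by (simp add: sum_list_triv)
  have "(\<Sum>(a, s)\<leftarrow>its. card (probe_blocks E B s l b)) \<le> (\<Sum>x\<leftarrow>its. 2 * b + 4)"
    using card_probe_blocks_le[OF assms(2)] by (intro sum_list_mono) auto
  then have "(\<Sum>(a, s)\<leftarrow>its. card (probe_blocks E B s l b)) \<le> length its * (2 * b + 4)"
    by (simp add: sum_list_triv)
  with 1 have "step_reads E B b l ?h its cache \<le> length its * (2 * b + 4) + length its * (2 * b + 4)"
    unfolding step_reads_def by linarith
  also have "\<dots> = length its * (4 * b + 8)" by (simp add: algebra_simps)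
  also have "\<dots> \<le> length its * (6 * b)" using assms(3) by (intro mult_left_mono) auto
  finally show ?thesis by (simp add: mult.commute)
qed

text \<open>Consecutive slices \<open>[l, h]\<close> are disjoint, but the progress guarantee concerns \<open>[l, h + 1]\<close>;
  counting from \<open>l\<close> and from \<open>l + 1\<close> makes every step decrease the potential.\<close>

definition potential :: "graph \<Rightarrow> item list \<Rightarrow> nat \<Rightarrow> nat" where
  "potential E its l = (\<Sum>(a, s)\<leftarrow>its. card (slice E s l \<infinity>) + card (slice E s (Suc l) \<infinity>))"

lemma potential_le:
  assumes "finite E"
  shows "potential E its l \<le> 2 * length its * card E"
proof -
  have "potential E its l \<le> (\<Sum>x\<leftarrow>its. 2 * card E)"
    unfolding potential_def
  proof (rule sum_list_mono)
    fix x :: item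
    obtain a s where x: "x = (a, s)" by fastforce
    show "(case x of (a, s) \<Rightarrow> card (slice E s l \<infinity>) + card (slice E s (Suc l) \<infinity>)) \<le> 2 * card E"
      using card_slice_le[OF assms, of s l \<infinity>] card_slice_le[OF assms, of s "Suc l" \<infinity>]
      unfolding x by simp
  qed
  then show ?thesis by (simp add: sum_list_triv)
qed

text \<open>The two summands of an item are compared crosswise. The tuples from \<open>h + 2\<close>
  on are those from \<open>l\<close> on without the slice \<open>[l, h + 1]\<close>, and those from
  \<open>h + 1\<close> on are among those from \<open>l + 1\<close> on. So no item gains, and the
  item whose slice \<open>[l, h + 1]\<close> does not fit loses all tuples of that slice.\<close>

lemma potential_decrease:
  assumes "finite E" "B > 0" "b \<ge> 6" "its \<noteq> []" "high E B b l its = enat h"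
  shows "real (potential E its (Suc h)) + real b * real B / 6 \<le> real (potential E its l)"
proof -
  obtain a s where as: "(a, s) \<in> set its" "\<not> fits E B s l b (enat (Suc h))"
    using high_maximal[OF assms(1,4,5)] by blast
  have lh: "l \<le> h" using low_le_high[OF assms(1), of l B b its] assms(5) by simp
  let ?n = "\<lambda>s l. card (slice E s l \<infinity>)"
  have g: "real b * real B / 6 \<le> real (card (slice E s l (enat (Suc h))))"
    using card_ge_of_trie_blocks_gt[OF finite_slice[OF assms(1)] assms(2,3)] as(2)
    by (simp add: fits_def)
  have add: "?n t (Suc (Suc h)) + card (slice E t l (enat (Suc h))) = ?n t l" for t
    using card_slice_add[OF assms(1), of l "Suc h" t] lh by simp
  have dec: "?n t (Suc h) \<le> ?n t (Suc l)" for t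
    using card_slice_add[OF assms(1), of "Suc l" h t] lh by simp
  have le: "?n t (Suc h) + ?n t (Suc (Suc h)) \<le> ?n t l + ?n t (Suc l)" for t
    using add[of t] dec[of t] by linarith
  obtain xs ys where its: "its = xs @ (a, s) # ys" using as(1) by (meson split_list)
  have "potential E zs (Suc h) \<le> potential E zs l" for zs
    unfolding potential_def using le by (intro sum_list_mono) auto
  then have "potential E xs (Suc h) \<le> potential E xs l" "potential E ys (Suc h) \<le> potential E ys l"
    by auto
  moreover have "potential E its k = potential E xs k + (?n s k + ?n s (Suc k)) + potential E ys k" for k
    by (simp add: potential_def its)
  ultimately show ?thesis using g add[of s] dec[of s] by simp
qed

section \<open>A pass of one dimension\<close>

definition coord :: "nat \<Rightarrow> nat \<times> nat \<times> nat \<Rightarrow> nat" where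
  "coord i = (\<lambda>(x, y, z). if i = 1 then x else if i = 2 then y else z)"

text \<open>The call of BoxUp\<open>(i + 1)\<close>, or of the in-memory join, that BoxUp\<open>(i)\<close> makes for \<open>low[i] = l\<close>.\<close>

definition inner_run ::
  "graph \<Rightarrow> nat \<Rightarrow> nat \<Rightarrow> (nat \<Rightarrow> nat \<Rightarrow> nat) \<Rightarrow> nat \<Rightarrow> nat \<Rightarrow> nat \<Rightarrow> item list \<Rightarrow>
   (atom \<Rightarrow> graph) \<Rightarrow> run option" where
  "inner_run E M B pass i mem l sp prov =
     (let its = items_at i sp;
          b = mem div length its;
          spilled = spilled_items E B b l its;
          kept = kept_items E B b l its;
          h = high E B b l its;
          prov' = provision E l h kept prov;
          sp' = sp @ map (\<lambda>(a, s). (a, Some l)) spilled;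
          unused = mem - used_blocks E B l h kept
      in if i < 3
         then boxup E M B pass (Suc i) (dim_blocks M B + min unused (pass i unused)) 0 sp' (\<lambda>_. {}) prov'
         else Some \<lparr> reads = 0, results = lftj prov', has_spill = False \<rparr>)"

text \<open>Separates the inner call from the rest of the pass, so that one induction serves all
  dimensions. The first hypothesis excludes an atom spilling at its last variable.\<close>

lemma boxup_step:
  assumes "\<forall>(a, s)\<in>set (spilled_items E B (mem div length (items_at i sp)) l (items_at i sp)). s = None"
    and "its = items_at i sp" "b = mem div length its" "h = high E B b l its"
    and "this_step = \<lparr> reads = step_reads E B b l h its cache, results = [],
            has_spill = (spilled_items E B b l its \<noteq> []) \<rparr>"
  shows "boxup E M B pass i mem l sp cache prov =
    do { inner \<leftarrow> inner_run E M B pass i mem l sp prov;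
         if h = \<infinity> then Some (then_run this_step inner)
         else do {
           rest \<leftarrow> boxup E M B pass i mem (Suc (the_enat h)) sp
             (update_cache E B l h (kept_items E B b l its) cache) prov;
           Some (then_run this_step (then_run inner rest)) } }"
proof -
  have ns: "(\<exists>(a, s)\<in>set (spilled_items E B (mem div length (items_at i sp)) l (items_at i sp)). s \<noteq> None)
      = False"
    using assms(1) by auto
  show ?thesis
    unfolding boxup.simps[of E M B pass i mem l sp cache prov] inner_run_def Let_def assms(2-5) ns
    by (simp only: if_False)
qed

lemma start_None_of_spilled:
  assumes "finite E" "B > 0" "b \<ge> 4" "(a, s) \<in> set (spilled_items E B b l its)"
  shows "s = None"
proof (cases s)
  case (Some v)
  then show ?thesis
    using probe_start_value[OF assms(1-3), of v l] assms(4) by (simp add: spilled_items_def)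
qed

text \<open>Induction on the potential, which also yields termination. Each step except the last
  lowers it by at least b B / 6, so the first factor bounds the number of steps; the second bounds
  the cost of one step, namely 6 mem of its own plus the inner run. \<open>R\<close> bounds every
  inner run, \<open>R'\<close> a spill-free one inside a step that does not spill.\<close>

lemma boxup_pass:
  fixes R R' :: real and T :: "(nat \<times> nat \<times> nat) set"
  assumes "finite E" "B > 0"
    and its: "its = items_at i sp" "its \<noteq> []" "length its \<le> 2"
    and b: "b = mem div length its" "b \<ge> 6"
    and R: "R' \<ge> 0" "R \<ge> R'"
    and inner: "\<And>l. \<exists>r. inner_run E M B pass i mem l sp prov = Some r \<and> real (reads r) \<le> R
        \<and> (spilled_items E B b l its = [] \<longrightarrow> \<not> has_spill r \<longrightarrow> real (reads r) \<le> R')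
        \<and> distinct (results r)
        \<and> set (results r) \<subseteq> T \<inter> {t. l \<le> coord i t \<and> enat (coord i t) \<le> high E B b l its}"
  shows "\<exists>r. boxup E M B pass i mem l sp cache prov = Some r
     \<and> real (reads r) \<le> (1 + 6 * real (potential E its l) / (real b * real B)) * (6 * real mem + R)
     \<and> (\<not> has_spill r \<longrightarrow>
          real (reads r) \<le> (1 + 6 * real (potential E its l) / (real b * real B)) * (6 * real mem + R'))
     \<and> distinct (results r) \<and> set (results r) \<subseteq> T \<inter> {t. l \<le> coord i t}"
proof (induction "potential E its l" arbitrary: l cache rule: less_induct)
  case less
  define h where "h = high E B b l its"
  define this_step where "this_step = \<lparr> reads = step_reads E B b l h its cache,
    results = [] :: (nat \<times> nat \<times> nat) list, has_spill = (spilled_items E B b l its \<noteq> []) \<rparr>"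
  let ?f = "\<lambda>l. 1 + 6 * real (potential E its l) / (real b * real B)"
  have bB: "real b * real B > 0" using b(2) assms(2) by simp
  have f1: "?f l \<ge> 1" for l using bB by simp
  have start: "\<forall>(a, s)\<in>set (spilled_items E B (mem div length (items_at i sp)) l (items_at i sp)). s = None"
  proof -
    have "s = None" if "(a, s) \<in> set (spilled_items E B b l its)" for a s
      using start_None_of_spilled[OF assms(1,2) _ that] b(2) by simp
    then show ?thesis unfolding its(1)[symmetric] b(1)[symmetric] by blast
  qed
  note step = boxup_step[OF start its(1) b(1) h_def this_step_def, where M=M and pass=pass and prov=prov]
  obtain r where r: "inner_run E M B pass i mem l sp prov = Some r" "real (reads r) \<le> R"
      "spilled_items E B b l its = [] \<Longrightarrow> \<not> has_spill r \<Longrightarrow> real (reads r) \<le> R'"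
      "distinct (results r)" "set (results r) \<subseteq> T \<inter> {t. l \<le> coord i t \<and> enat (coord i t) \<le> h}"
    using inner[of l] unfolding h_def by blast
  have "length its * b \<le> mem" unfolding b(1) by simp
  moreover have "step_reads E B b l h its cache \<le> 6 * b * length its"
    using step_reads_le[OF assms(1,2) b(2)] unfolding h_def .
  ultimately have "step_reads E B b l h its cache \<le> 6 * mem" by (simp add: algebra_simps)
  then have s: "real (reads this_step) \<le> 6 * real mem" by (simp add: this_step_def)
  show ?case
  proof (cases h)
    case infinity
    have run: "boxup E M B pass i mem l sp cache prov = Some (then_run this_step r)"
      unfolding step r(1) using infinity by simp
    \<comment> \<open>The summand 1 of the factor pays for the last step.\<close>
    have mul: "6 * real mem + X \<le> ?f l * (6 * real mem + X)" if "X \<ge> 0" for X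
      using mult_right_mono[OF f1[of l], of "6 * real mem + X"] that by simp
    have "real (reads (then_run this_step r)) \<le> ?f l * (6 * real mem + R)"
      using mul[of R] R r(2) s by (simp add: then_run_def)
    moreover have "real (reads (then_run this_step r)) \<le> ?f l * (6 * real mem + R')"
      if "\<not> has_spill (then_run this_step r)"
      using mul[of R'] R r(3) s that by (simp add: then_run_def this_step_def)
    ultimately show ?thesis
      unfolding run using r(4,5) by (auto simp: then_run_def this_step_def)
  next
    case (enat k)
    have dec: "real (potential E its (Suc k)) + real b * real B / 6 \<le> real (potential E its l)"
      using potential_decrease[OF assms(1,2) b(2) its(2)] enat unfolding h_def by blast
    then have "potential E its (Suc k) < potential E its l" using bB by linarith
    from less[OF this, of "update_cache E B l h (kept_items E B b l its) cache"]
    obtain q where q: "boxup E M B pass i mem (Suc k) sp (update_cache E B l h (kept_items E B b l its) cache) prov = Some q"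
      "real (reads q) \<le> ?f (Suc k) * (6 * real mem + R)"
      "\<not> has_spill q \<Longrightarrow> real (reads q) \<le> ?f (Suc k) * (6 * real mem + R')"
      "distinct (results q)" "set (results q) \<subseteq> T \<inter> {t. Suc k \<le> coord i t}"
      by blast
    let ?r = "then_run this_step (then_run r q)"
    have run: "boxup E M B pass i mem l sp cache prov = Some ?r"
      unfolding step r(1) using enat q(1) by simp
    \<comment> \<open>A decrease of the potential by b B / 6 lowers the factor by one, which pays
      for the current step.\<close>
    have "?f (Suc k) + 1 \<le> ?f l"
      using dec bB by (simp add: field_simps)
    then have mul: "(6 * real mem + X) + ?f (Suc k) * (6 * real mem + X) \<le> ?f l * (6 * real mem + X)"
      if "X \<ge> 0" for X
      using mult_right_mono[of "?f (Suc k) + 1" "?f l" "6 * real mem + X"] that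
      by (simp add: algebra_simps)
    have "real (reads ?r) \<le> ?f l * (6 * real mem + R)"
      using mul[of R] R r(2) s q(2) by (simp add: then_run_def)
    moreover have "real (reads ?r) \<le> ?f l * (6 * real mem + R')"
      if "\<not> has_spill ?r"
      using mul[of R'] R r(3) s q(3) that by (simp add: then_run_def this_step_def)
    moreover have "distinct (results ?r)"
    proof -
      \<comment> \<open>Coordinate \<open>i\<close> is at most \<open>k\<close> in the current box
        and at least \<open>k + 1\<close> in all later ones.\<close>
      have "set (results r) \<inter> set (results q) = {}" using r(5) q(5) enat by fastforce
      then show ?thesis using r(4) q(4) by (simp add: then_run_def this_step_def)
    qed
    moreover have "l \<le> k" using low_le_high[OF assms(1), of l B b its] enat by (simp add: h_def)
    then have "set (results ?r) \<subseteq> T \<inter> {t. l \<le> coord i t}"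
      using r(5) q(5) by (auto simp: then_run_def this_step_def)
    ultimately show ?thesis unfolding run by blast
  qed
qed

section \<open>The nested passes of the triangle query\<close>

text \<open>The list of an infinite set is empty by default, so this holds without
  finiteness.\<close>

lemma in_sorted_list_of_setD: "x \<in> set (sorted_list_of_set A) \<Longrightarrow> x \<in> A"
  by (cases "finite A") auto

lemma set_lftj:
  assumes "(a, b, c) \<in> set (lftj R)"
  shows "(a, b) \<in> R (1, 2)" "(a, c) \<in> R (1, 3)" "(b, c) \<in> R (2, 3)"
  using assms by (auto simp: lftj_def D_def dest!: in_sorted_list_of_setD)

lemma distinct_concat_map:
  assumes "distinct xs" "\<And>x. x \<in> set xs \<Longrightarrow> distinct (f x)"
    and "\<And>x y. x \<in> set xs \<Longrightarrow> y \<in> set xs \<Longrightarrow> x \<noteq> y \<Longrightarrow> set (f x) \<inter> set (f y) = {}"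
  shows "distinct (concat (map f xs))"
  using assms by (induction xs) force+

lemma distinct_lftj: "distinct (lftj R)"
  unfolding lftj_def
  by (intro distinct_concat_map) (auto simp: distinct_map inj_on_def)

lemma items_at_eq:
  "items_at 1 sp = ((1, 2), None) # ((1, 3), None) # filter (\<lambda>(a, s). snd a = 1) sp"
  "items_at 2 sp = ((2, 3), None) # filter (\<lambda>(a, s). snd a = 2) sp"
  "items_at 3 sp = filter (\<lambda>(a, s). snd a = 3) sp"
proof -
  have "concat (map (\<lambda>(a, s). if snd a = i then [(a, s)] else []) sp) = filter (\<lambda>(a, s). snd a = i) sp"
    for i :: nat by (induction sp) auto
  then show "items_at 1 sp = ((1, 2), None) # ((1, 3), None) # filter (\<lambda>(a, s). snd a = 1) sp"
    "items_at 2 sp = ((2, 3), None) # filter (\<lambda>(a, s). snd a = 2) sp"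
    "items_at 3 sp = filter (\<lambda>(a, s). snd a = 3) sp"
    by (simp_all add: items_at_def atoms_def)
qed

text \<open>Bounds the number of steps of a pass: at most 2 atoms with at least \<open>d div 2\<close> blocks each, so the
  potential starts at most at \<open>4 |E|\<close> and decreases by \<open>(d div 2) B / 6\<close> per step.\<close>

definition step_bound :: "graph \<Rightarrow> nat \<Rightarrow> nat \<Rightarrow> real" where
  "step_bound E B d = 1 + 24 * real (card E) / (real (d div 2) * real B)"

lemma step_bound_ge_1: "step_bound E B d \<ge> 1"
  by (simp add: step_bound_def)

text \<open>Makes the bound independent of \<open>l\<close> and of the exact memory. Sharing at
  least d blocks among at most two items leaves each at least \<open>d div 2\<close>, and d >= 12
  makes this at least 6.\<close>

lemma boxup_pass_step_bound:
  fixes R R' :: real and T :: "(nat \<times> nat \<times> nat) set"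
  assumes "finite E" "B > 0" "d \<ge> 12" "d \<le> mem"
    and its: "its = items_at i sp" "its \<noteq> []" "length its \<le> 2"
    and b: "b = mem div length its"
    and R: "R' \<ge> 0" "R \<ge> R'"
    and inner: "\<And>l. b \<ge> 6 \<Longrightarrow> \<exists>r. inner_run E M B pass i mem l sp prov = Some r \<and> real (reads r) \<le> R
        \<and> (spilled_items E B b l its = [] \<longrightarrow> \<not> has_spill r \<longrightarrow> real (reads r) \<le> R')
        \<and> distinct (results r)
        \<and> set (results r) \<subseteq> T \<inter> {t. l \<le> coord i t \<and> enat (coord i t) \<le> high E B b l its}"
  shows "\<exists>r. boxup E M B pass i mem l sp cache prov = Some r
     \<and> real (reads r) \<le> step_bound E B d * (6 * real mem + R)
     \<and> (\<not> has_spill r \<longrightarrow> real (reads r) \<le> step_bound E B d * (6 * real mem + R'))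
     \<and> distinct (results r) \<and> set (results r) \<subseteq> T"
proof -
  have "length its = 1 \<or> length its = 2" using its(2,3) length_greater_0_conv[of its] by linarith
  then have "d div 2 \<le> b" using assms(4) div_le_mono[OF assms(4), of 2] unfolding b by auto
  then have db: "d div 2 \<le> b" "b \<ge> 6" using assms(3) by auto
  have "2 * length its * card E \<le> 2 * 2 * card E"
    using its(3) by (intro mult_right_mono mult_left_mono) auto
  then have "potential E its l \<le> 4 * card E" using potential_le[OF assms(1), of its l] by linarith
  then have "6 * real (potential E its l) \<le> 24 * real (card E)" by simp
  moreover have "real (d div 2) * real B \<le> real b * real B" "0 < real (d div 2) * real B"
    using db assms(2,3) by (auto intro!: mult_right_mono)
  ultimately have "6 * real (potential E its l) / (real b * real B) \<le> 24 * real (card E) / (real (d div 2) * real B)"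
    by (intro frac_le) auto
  then have le: "1 + 6 * real (potential E its l) / (real b * real B) \<le> step_bound E B d"
    by (simp add: step_bound_def)
  obtain r where r: "boxup E M B pass i mem l sp cache prov = Some r"
     "real (reads r) \<le> (1 + 6 * real (potential E its l) / (real b * real B)) * (6 * real mem + R)"
     "\<not> has_spill r \<Longrightarrow>
          real (reads r) \<le> (1 + 6 * real (potential E its l) / (real b * real B)) * (6 * real mem + R')"
     "distinct (results r)" "set (results r) \<subseteq> T \<inter> {t. l \<le> coord i t}"
    using boxup_pass[OF assms(1,2) its b db(2) R inner[OF db(2)], of l cache] by blast
  have "real (reads r) \<le> step_bound E B d * (6 * real mem + R)"
    using r(2) mult_right_mono[OF le, of "6 * real mem + R"] R by linarith
  moreover have "real (reads r) \<le> step_bound E B d * (6 * real mem + R')" if "\<not> has_spill r"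
    using r(3)[OF that] mult_right_mono[OF le, of "6 * real mem + R'"] R by linarith
  ultimately show ?thesis using r(1,4,5) by blast
qed

text \<open>\<open>p\<close> and \<open>q\<close> tell whether E(x,z) and E(y,z) have spilled, with
  values \<open>x\<close> and \<open>y\<close>; \<open>X\<close> and \<open>Y\<close> are the ranges
  of the enclosing box. If neither has, there is nothing to load and the join runs once. Otherwise
  the inner run is the in-memory join, free of reads, so one pass is the whole cost, with 6 mem <=
  18 d per step.\<close>

lemma boxup_3:
  assumes "finite E" "B > 0" "d \<ge> 12" "d \<le> mem" "mem \<le> 3 * d"
    and its: "items_at 3 sp = (if p then [((1, 3), Some x)] else []) @ (if q then [((2, 3), Some y)] else [])"
    and prov: "prov (1, 2) \<subseteq> E \<inter> X \<times> UNIV" "\<not> p \<Longrightarrow> prov (1, 3) \<subseteq> E"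
      "\<not> q \<Longrightarrow> prov (2, 3) \<subseteq> E \<inter> Y \<times> UNIV" "q \<Longrightarrow> y \<in> Y"
  shows "\<exists>r. boxup E M B pass 3 mem 0 sp (\<lambda>_. {}) prov = Some r
     \<and> real (reads r) \<le> step_bound E B d * (18 * real d)
     \<and> (\<not> p \<longrightarrow> \<not> q \<longrightarrow> reads r = 0)
     \<and> distinct (results r) \<and> set (results r) \<subseteq> triangles E \<inter> X \<times> Y \<times> UNIV"
proof -
  define its where "its = items_at 3 sp"
  define b where "b = mem div length its"
  have its_eq: "its = (if p then [((1, 3), Some x)] else []) @ (if q then [((2, 3), Some y)] else [])"
    using its by (simp add: its_def)
  \<comment> \<open>E(x,y) confines x to \<open>X\<close>. E(y,z) confines y to \<open>Y\<close>,
    through its earlier slice or, once spilled, through its start value. Any atom handled here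
    confines z to \<open>[l, h]\<close>.\<close>
  have tri: "(a1, a2, a3) \<in> triangles E \<inter> X \<times> Y \<times> UNIV \<and> (its \<noteq> [] \<longrightarrow> l \<le> a3 \<and> enat a3 \<le> h)"
    if "(a1, a2, a3) \<in> set (lftj (provision E l h its prov))" for l h a1 a2 a3
    using set_lftj[OF that] prov unfolding its_eq
    by (cases p; cases q) (auto simp: provision_def triangles_def slice_def)
  show ?thesis
  proof (cases "its = []")
    case True
    have st: "step_reads E B b 0 \<infinity> its (\<lambda>_. {}) = 0"
      using True by (simp add: step_reads_def kept_items_def)
    \<comment> \<open>The infimum over no items is \<infinity>, so the pass is a single
      step.\<close>
    have "kept_items E B b 0 its = its" "spilled_items E B b 0 its = []" "high E B b 0 its = \<infinity>"
      using True by (simp_all add: kept_items_def spilled_items_def high_def top_enat_def)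
    then have "boxup E M B pass 3 mem 0 sp (\<lambda>_. {}) prov
        = Some \<lparr> reads = 0, results = lftj (provision E 0 \<infinity> its prov), has_spill = False \<rparr>"
      using st unfolding boxup.simps[of E M B pass 3 mem 0 sp] its_def[symmetric] Let_def b_def[symmetric]
      by (simp add: then_run_def)
    moreover have "set (lftj (provision E 0 \<infinity> its prov)) \<subseteq> triangles E \<inter> X \<times> Y \<times> UNIV"
      using tri by fastforce
    moreover have "step_bound E B d * (18 * real d) \<ge> 0"
      using step_bound_ge_1[of E B d] by simp
    ultimately show ?thesis using distinct_lftj by simp
  next
    case False
    have inner: "\<exists>r. inner_run E M B pass 3 mem l sp prov = Some r \<and> real (reads r) \<le> 0
        \<and> (spilled_items E B b l its = [] \<longrightarrow> \<not> has_spill r \<longrightarrow> real (reads r) \<le> 0)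
        \<and> distinct (results r)
        \<and> set (results r) \<subseteq> (triangles E \<inter> X \<times> Y \<times> UNIV)
            \<inter> {t. l \<le> coord 3 t \<and> enat (coord 3 t) \<le> high E B b l its}"
      if "b \<ge> 6" for l
    proof -
      have "probe E B (Some v) l b \<noteq> None" for v
        using probe_start_value[OF assms(1,2)] that by simp
      then have kept: "kept_items E B b l its = its"
        unfolding its_eq by (auto simp: kept_items_def)
      let ?r = "\<lparr> reads = 0, results = lftj (provision E l (high E B b l its) its prov), has_spill = False \<rparr>"
      have "inner_run E M B pass 3 mem l sp prov = Some ?r"
        unfolding inner_run_def Let_def its_def[symmetric] b_def[symmetric] kept by simp
      moreover have "set (results ?r) \<subseteq> (triangles E \<inter> X \<times> Y \<times> UNIV)
            \<inter> {t. l \<le> coord 3 t \<and> enat (coord 3 t) \<le> high E B b l its}"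
        using tri[of _ _ _ l "high E B b l its"] False by (fastforce simp: coord_def)
      ultimately show ?thesis using distinct_lftj by fastforce
    qed
    have "length its \<le> 2" unfolding its_eq by simp
    from boxup_pass_step_bound[OF assms(1-4) its_def False this b_def _ _ inner, of 0 "\<lambda>_. {}"]
    obtain r where r: "boxup E M B pass 3 mem 0 sp (\<lambda>_. {}) prov = Some r"
      "real (reads r) \<le> step_bound E B d * (6 * real mem)"
      "distinct (results r)" "set (results r) \<subseteq> triangles E \<inter> X \<times> Y \<times> UNIV"
      by auto
    have "step_bound E B d * (6 * real mem) \<le> step_bound E B d * (18 * real d)"
      using assms(5) step_bound_ge_1[of E B d] by (intro mult_left_mono) auto
    with r(2) have "real (reads r) \<le> step_bound E B d * (18 * real d)" by (rule order_trans)
    moreover have "p \<or> q" using False unfolding its_eq by (cases p; cases q) simp_all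
    ultimately show ?thesis using r(1,3,4) by blast
  qed
qed

text \<open>\<open>p\<close> tells whether the two atoms of x have spilled. If so, E(x,y) is handled
  here next to E(y,z), while E(x,z) waits for dimension 3. Without any spill dimension 3 reads
  nothing, so only the own reads of at most 6 mem <= 12 d per step remain.\<close>

lemma boxup_2:
  assumes "finite E" "B > 0" "dim_blocks M B = d" "d \<ge> 12" "d \<le> mem" "mem \<le> 2 * d"
    and sp: "sp = (if p then [((1, 2), Some x), ((1, 3), Some x)] else [])"
    and prov: "\<not> p \<Longrightarrow> prov (1, 2) \<subseteq> E \<inter> X \<times> UNIV" "\<not> p \<Longrightarrow> prov (1, 3) \<subseteq> E" "p \<Longrightarrow> x \<in> X"
  shows "\<exists>r. boxup E M B pass 2 mem 0 sp (\<lambda>_. {}) prov = Some r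
     \<and> real (reads r) \<le> step_bound E B d * (12 * real d + step_bound E B d * (18 * real d))
     \<and> (\<not> p \<longrightarrow> \<not> has_spill r \<longrightarrow> real (reads r) \<le> step_bound E B d * (12 * real d))
     \<and> distinct (results r) \<and> set (results r) \<subseteq> triangles E \<inter> X \<times> UNIV"
proof -
  define its where "its = items_at 2 sp"
  define b where "b = mem div length its"
  define R where "R = step_bound E B d * (18 * real d)"
  \<comment> \<open>Under \<open>p\<close> dimension 3 reads E(x,z) even if the current step spills
    nothing.\<close>
  define R' where "R' = (if p then R else 0)"
  have s0: "step_bound E B d \<ge> 0" using step_bound_ge_1[of E B d] by simp
  have RR: "R' \<ge> 0" "R \<ge> R'" using s0 by (auto simp: R_def R'_def)
  have its_eq: "its = ((2, 3), None) # (if p then [((1, 2), Some x)] else [])"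
    by (simp add: its_def sp items_at_eq)
  have inner: "\<exists>r. inner_run E M B pass 2 mem l sp prov = Some r \<and> real (reads r) \<le> R
      \<and> (spilled_items E B b l its = [] \<longrightarrow> \<not> has_spill r \<longrightarrow> real (reads r) \<le> R')
      \<and> distinct (results r)
      \<and> set (results r) \<subseteq> (triangles E \<inter> X \<times> UNIV)
          \<inter> {t. l \<le> coord 2 t \<and> enat (coord 2 t) \<le> high E B b l its}"
    if "b \<ge> 6" for l
  proof -
    define q where "q \<longleftrightarrow> probe E B None l b = None"
    define h where "h = high E B b l its"
    define Y where "Y = {v. l \<le> v \<and> enat v \<le> h}"
    have some: "probe E B (Some v) l b \<noteq> None" for v
      using probe_start_value[OF assms(1,2)] that by simp
    have spilled: "spilled_items E B b l its = (if q then [((2, 3), None)] else [])"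
      using some unfolding its_eq q_def by (auto simp: spilled_items_def)
    have kept: "kept_items E B b l its
        = (if q then [] else [((2, 3), None)]) @ (if p then [((1, 2), Some x)] else [])"
      using some unfolding its_eq q_def by (auto simp: kept_items_def)
    define prov' where "prov' = provision E l h (kept_items E B b l its) prov"
    define sp' where "sp' = sp @ map (\<lambda>(a, s). (a, Some l)) (spilled_items E B b l its)"
    define unused where "unused = mem - used_blocks E B l h (kept_items E B b l its)"
    let ?mem = "dim_blocks M B + min unused (pass 2 unused)"
    have run: "inner_run E M B pass 2 mem l sp prov = boxup E M B pass 3 ?mem 0 sp' (\<lambda>_. {}) prov'"
      unfolding inner_run_def Let_def its_def[symmetric] b_def[symmetric] h_def[symmetric]
        prov'_def[symmetric] sp'_def[symmetric] unused_def[symmetric] by simp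
    \<comment> \<open>Dimension 3 has its own d blocks and receives at most the 2 d of this
      dimension.\<close>
    have mem: "d \<le> ?mem" "?mem \<le> 3 * d"
      using assms(3,6) unfolding unused_def by auto
    have items: "items_at 3 sp' = (if p then [((1, 3), Some x)] else []) @ (if q then [((2, 3), Some l)] else [])"
      unfolding sp'_def spilled items_at_eq sp by simp
    \<comment> \<open>A spilling step covers the value \<open>l\<close> alone, so the start value of
      the spilled atom lies in \<open>Y\<close>.\<close>
    have "q \<Longrightarrow> h = enat l" unfolding h_def high_def spilled by simp
    then have Y: "q \<Longrightarrow> l \<in> Y" by (simp add: Y_def)
    have "prov' (1, 2) \<subseteq> E \<inter> X \<times> UNIV" "\<not> p \<Longrightarrow> prov' (1, 3) \<subseteq> E"
      "\<not> q \<Longrightarrow> prov' (2, 3) \<subseteq> E \<inter> Y \<times> UNIV"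
      unfolding prov'_def kept using prov
      by (cases p; cases q; auto simp: provision_def slice_def Y_def)+
    from boxup_3[OF assms(1,2,4) mem items this Y, of M pass]
    obtain r where r: "inner_run E M B pass 2 mem l sp prov = Some r"
      "real (reads r) \<le> R" "\<not> p \<Longrightarrow> \<not> q \<Longrightarrow> reads r = 0"
      "distinct (results r)" "set (results r) \<subseteq> triangles E \<inter> X \<times> Y \<times> UNIV"
      unfolding run R_def by blast
    have "real (reads r) \<le> R'" if "spilled_items E B b l its = []"
      using that r(2,3) unfolding spilled R'_def by (auto split: if_splits)
    moreover have "triangles E \<inter> X \<times> Y \<times> UNIV
        \<subseteq> (triangles E \<inter> X \<times> UNIV) \<inter> {t. l \<le> coord 2 t \<and> enat (coord 2 t) \<le> h}"
      by (auto simp: Y_def coord_def)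
    ultimately show ?thesis using r unfolding h_def by blast
  qed
  have "length its \<le> 2" "its \<noteq> []" unfolding its_eq by simp_all
  from boxup_pass_step_bound[OF assms(1,2,4,5) its_def this(2,1) b_def RR inner, of 0 "\<lambda>_. {}"]
  obtain r where r: "boxup E M B pass 2 mem 0 sp (\<lambda>_. {}) prov = Some r"
    "real (reads r) \<le> step_bound E B d * (6 * real mem + R)"
    "\<not> has_spill r \<Longrightarrow> real (reads r) \<le> step_bound E B d * (6 * real mem + R')"
    "distinct (results r)" "set (results r) \<subseteq> triangles E \<inter> X \<times> UNIV"
    by blast
  have le: "step_bound E B d * (6 * real mem + Q) \<le> step_bound E B d * (12 * real d + Q)" for Q
    using assms(6) s0 by (intro mult_left_mono) auto
  have "real (reads r) \<le> step_bound E B d * (12 * real d + R)"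
    using r(2) le by (rule order_trans)
  moreover have "real (reads r) \<le> step_bound E B d * (12 * real d)" if "\<not> p" "\<not> has_spill r"
    using order_trans[OF r(3)[OF that(2)] le] that(1) by (simp add: R'_def)
  ultimately show ?thesis using r(1,4,5) unfolding R_def by blast
qed

lemma boxed_lftj_reads:
  assumes "finite E" "B > 0" "dim_blocks M B = d" "d \<ge> 12"
  shows "\<exists>r. boxed_lftj E M B pass = Some r
     \<and> real (reads r) \<le> step_bound E B d * (6 * real d
           + step_bound E B d * (12 * real d + step_bound E B d * (18 * real d)))
     \<and> (\<not> has_spill r \<longrightarrow>
          real (reads r) \<le> step_bound E B d * (6 * real d + step_bound E B d * (12 * real d)))
     \<and> distinct (results r) \<and> set (results r) \<subseteq> triangles E"
proof -
  define its where "its = items_at 1 []"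
  define b where "b = d div length its"
  define R where "R = step_bound E B d * (12 * real d + step_bound E B d * (18 * real d))"
  define R' where "R' = step_bound E B d * (12 * real d)"
  have s0: "step_bound E B d \<ge> 0" using step_bound_ge_1[of E B d] by simp
  have RR: "R' \<ge> 0" "R \<ge> R'" using s0 by (auto simp: R_def R'_def intro!: mult_left_mono)
  have its_eq: "its = [((1, 2), None), ((1, 3), None)]"
    unfolding its_def items_at_eq by simp
  have inner: "\<exists>r. inner_run E M B pass 1 d l [] (\<lambda>_. {}) = Some r \<and> real (reads r) \<le> R
      \<and> (spilled_items E B b l its = [] \<longrightarrow> \<not> has_spill r \<longrightarrow> real (reads r) \<le> R')
      \<and> distinct (results r)
      \<and> set (results r) \<subseteq> triangles E \<inter> {t. l \<le> coord 1 t \<and> enat (coord 1 t) \<le> high E B b l its}"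
    for l
  proof -
    define p where "p \<longleftrightarrow> probe E B None l b = None"
    define h where "h = high E B b l its"
    define X where "X = {v. l \<le> v \<and> enat v \<le> h}"
    \<comment> \<open>Both atoms probe the same relation with the same empty start tuple and budget,
      so they spill together or not at all.\<close>
    have spilled: "spilled_items E B b l its = (if p then its else [])"
      unfolding its_eq p_def by (auto simp: spilled_items_def)
    have kept: "kept_items E B b l its = (if p then [] else its)"
      unfolding its_eq p_def by (auto simp: kept_items_def)
    define prov' where "prov' = provision E l h (kept_items E B b l its) (\<lambda>_. {})"
    define sp' where "sp' = map (\<lambda>(a, s). (a, Some l)) (spilled_items E B b l its)"
    define unused where "unused = d - used_blocks E B l h (kept_items E B b l its)"
    let ?mem = "dim_blocks M B + min unused (pass 1 unused)"
    have run: "inner_run E M B pass 1 d l [] (\<lambda>_. {}) = boxup E M B pass 2 ?mem 0 sp' (\<lambda>_. {}) prov'"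
      unfolding inner_run_def Let_def its_def[symmetric] b_def[symmetric] h_def[symmetric]
        prov'_def[symmetric] append_Nil sp'_def[symmetric] unused_def[symmetric] by (simp add: numeral_2_eq_2)
    have mem: "d \<le> ?mem" "?mem \<le> 2 * d"
      using assms(3) unfolding unused_def by auto
    have sp': "sp' = (if p then [((1, 2), Some l), ((1, 3), Some l)] else [])"
      unfolding sp'_def spilled by (simp add: its_eq)
    have "p \<Longrightarrow> h = enat l" unfolding h_def high_def spilled by (simp add: its_eq)
    then have X: "p \<Longrightarrow> l \<in> X" by (simp add: X_def)
    have "\<not> p \<Longrightarrow> prov' (1, 2) \<subseteq> E \<inter> X \<times> UNIV" "\<not> p \<Longrightarrow> prov' (1, 3) \<subseteq> E"
      unfolding prov'_def kept by (auto simp: its_eq provision_def slice_def X_def)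
    from boxup_2[OF assms mem sp' this X, of pass]
    obtain r where r: "inner_run E M B pass 1 d l [] (\<lambda>_. {}) = Some r"
      "real (reads r) \<le> R" "\<not> p \<Longrightarrow> \<not> has_spill r \<Longrightarrow> real (reads r) \<le> R'"
      "distinct (results r)" "set (results r) \<subseteq> triangles E \<inter> X \<times> UNIV"
      unfolding run R_def R'_def by blast
    have "real (reads r) \<le> R'" if "spilled_items E B b l its = []" "\<not> has_spill r"
      using that r(3) its_eq unfolding spilled by (auto split: if_splits)
    moreover have "triangles E \<inter> X \<times> UNIV
        \<subseteq> triangles E \<inter> {t. l \<le> coord 1 t \<and> enat (coord 1 t) \<le> h}"
      by (auto simp: X_def coord_def)
    ultimately show ?thesis using r unfolding h_def by blast
  qed
  have "length its \<le> 2" "its \<noteq> []" unfolding its_eq by simp_all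
  from boxup_pass_step_bound[OF assms(1,2,4) order_refl its_def this(2,1) b_def RR inner, of 0 "\<lambda>_. {}"]
  show ?thesis unfolding boxed_lftj_def assms(3) R_def R'_def .
qed

section \<open>Bounds in terms of |E|, M and B\<close>

lemma edge_relation_finite: "edge_relation E \<Longrightarrow> finite E"
  by (auto simp: edge_relation_def)

text \<open>More than 60 blocks of memory leave a constant fraction for each dimension after 20
  blocks are reserved. The factor 20 in the last bound leaves room for all roundings, with
  \<open>m + 1\<close> blocks covering the words lost in \<open>M div B\<close>.\<close>

lemma dim_blocks_bounds:
  assumes "B > 0" "real M / real B > 60"
  shows "dim_blocks M B \<ge> 12" "real (dim_blocks M B) \<le> real M / real B"
    "real M / 20 \<le> real (dim_blocks M B div 2) * real B"
proof -
  define m d where "m = M div B" and "d = dim_blocks M B"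
  have "60 * real B < real M" using assms by (simp add: field_simps)
  then have "60 * B \<le> M" by linarith
  then have m: "m \<ge> 60" using assms(1) div_le_mono[of "60 * B" M B] by (simp add: m_def)
  have d: "d = (m - 20) div 3" by (simp add: d_def m_def dim_blocks_def reserved_blocks_def)
  show "dim_blocks M B \<ge> 12" unfolding d_def[symmetric] d using m by simp
  have "d \<le> m" unfolding d by linarith
  moreover have "real m \<le> real M / real B" unfolding m_def by (rule of_nat_div_le_of_nat)
  ultimately show "real (dim_blocks M B) \<le> real M / real B" unfolding d_def by linarith
  have "m + 1 \<le> 20 * (d div 2)" unfolding d using m by linarith
  then have "(m + 1) * B \<le> 20 * (d div 2) * B" by (rule mult_right_mono) simp
  moreover have "M \<le> (m + 1) * B"
    using dividend_less_div_times[OF assms(1), of M] by (simp add: m_def)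
  ultimately have "M \<le> 20 * ((d div 2) * B)" by linarith
  then have "real M \<le> real (20 * ((d div 2) * B))" by (rule of_nat_mono)
  then show "real M / 20 \<le> real (dim_blocks M B div 2) * real B" by (simp add: d_def)
qed

text \<open>Since M <= \<kappa> |E|, the last step of a pass, counted as 1, is at most \<kappa> |E|
  / M; the other steps contribute 24 * 20 = 480 times |E| / M.\<close>

lemma step_bound_le:
  assumes "B > 0" "real M / real B > 60" "real M \<le> \<kappa> * real (card E)"
  shows "step_bound E B (dim_blocks M B) \<le> (\<kappa> + 480) * (real (card E) / real M)"
proof -
  have M: "real M > 0" using assms(1,2) by (cases "M = 0") auto
  have "24 * real (card E) / (real (dim_blocks M B div 2) * real B) \<le> 24 * real (card E) / (real M / 20)"
    using dim_blocks_bounds(3)[OF assms(1,2)] M by (intro frac_le) auto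
  also have "\<dots> = 480 * (real (card E) / real M)" by simp
  finally have "24 * real (card E) / (real (dim_blocks M B div 2) * real B) \<le> 480 * (real (card E) / real M)" .
  moreover have "1 \<le> \<kappa> * (real (card E) / real M)" using assms(3) M by (simp add: field_simps)
  ultimately show ?thesis by (simp add: step_bound_def algebra_simps)
qed

theorem corollary15:
  fixes \<kappa> :: real
  assumes "\<kappa> > 0"
  shows "\<exists>C > 0. \<forall>(E :: graph) (M :: nat) (B :: nat) (pass :: nat \<Rightarrow> nat \<Rightarrow> nat).
     edge_relation E \<longrightarrow> B > 0 \<longrightarrow>
     real (card E) / real B > log 2 (real (card E)) \<longrightarrow>
     real M / real B > 10 * 3 * 2 \<longrightarrow>
     real M \<le> \<kappa> * real (card E) \<longrightarrow>
     (\<exists>r. boxed_lftj E M B pass = Some r \<and>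
        real (io_count B r) \<le>
          C * (real (card E) ^ 3 / (real M ^ 2 * real B) + real (card (triangles E)) / real B) \<and>
        (\<not> has_spill r \<longrightarrow>
          real (io_count B r) \<le>
            C * (real (card E) ^ 2 / (real M * real B) + real (card (triangles E)) / real B)))"
proof -
  define c where "c = \<kappa> + 480"
  \<comment> \<open>36 = 6 + 12 + 18 and 18 = 6 + 12 are the weights of three and two nested passes,
    each increased by one for the rounded-up output block; 3 is the number of words per
    tuple.\<close>
  define C where "C = 37 * c ^ 3 + 19 * c ^ 2 + 3"
  have c: "c > 0" using assms by (simp add: c_def)
  have C: "C \<ge> 37 * c ^ 3" "C \<ge> 19 * c ^ 2" "C \<ge> 3" using c by (auto simp: C_def)
  then have "C > 0" by simp
  have "\<exists>r. boxed_lftj E M B pass = Some r \<and>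
        real (io_count B r) \<le>
          C * (real (card E) ^ 3 / (real M ^ 2 * real B) + real (card (triangles E)) / real B) \<and>
        (\<not> has_spill r \<longrightarrow>
          real (io_count B r) \<le>
            C * (real (card E) ^ 2 / (real M * real B) + real (card (triangles E)) / real B))"
    if E: "edge_relation E" and B: "B > 0" and MB: "real M / real B > 60"
      and ME: "real M \<le> \<kappa> * real (card E)"
    for E M B pass
  proof -
    define d S x K where "d = dim_blocks M B" and "S = step_bound E B d"
      and "x = real M / real B" and "K = real (card (triangles E)) / real B"
    define T where "T = c * (real (card E) / real M)"
    have fin: "finite E" using E by (rule edge_relation_finite)
    have M: "real M > 0" using MB by (cases "M = 0") auto
    have x: "x > 60" using MB by (simp add: x_def)
    have d: "12 \<le> d" "real d \<le> x" using dim_blocks_bounds[OF B MB] by (auto simp: d_def x_def)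
    have S: "1 \<le> S" "S \<le> T"
      using step_bound_ge_1 step_bound_le[OF B MB ME] by (auto simp: S_def T_def c_def d_def)
    have K: "K \<ge> 0" by (simp add: K_def)
    obtain r where r: "boxed_lftj E M B pass = Some r"
      "real (reads r) \<le> S * (6 * real d + S * (12 * real d + S * (18 * real d)))"
      "\<not> has_spill r \<Longrightarrow> real (reads r) \<le> S * (6 * real d + S * (12 * real d))"
      "distinct (results r)" "set (results r) \<subseteq> triangles E"
      using boxed_lftj_reads[OF fin B d_def[symmetric] d(1), of pass] unfolding S_def by blast
    \<comment> \<open>A triangle is determined by its edges \<open>(x, y)\<close> and
      \<open>(x, z)\<close>. Finiteness lets \<open>card\<close> bound the number of distinct
      results.\<close>
    have "triangles E \<subseteq> (\<lambda>((a, b), (_, e)). (a, b, e)) ` (E \<times> E)"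
      by (force simp: triangles_def)
    then have "finite (triangles E)" using fin by (meson finite_SigmaI finite_imageI finite_subset)
    then have "length (results r) \<le> card (triangles E)"
      using r(4,5) by (metis card_mono distinct_card)
    then have "3 * real (length (results r)) / real B \<le> 3 * K"
      by (simp add: K_def divide_right_mono)
    then have io: "real (io_count B r) \<le> real (reads r) + 3 * K + 1"
      unfolding io_count_def using K by linarith
    have le: "S ^ k * x \<le> T ^ k * x" for k
      using S x by (intro mult_right_mono power_mono) auto
    have S1: "1 \<le> S ^ k" for k using S(1) by (rule one_le_power)
    \<comment> \<open>Lets the read bounds absorb the extra output block.\<close>
    have one: "1 \<le> S ^ k * x" for k
      using mult_mono[OF S1[of k], of 1 x] x S1[of k] by linarith
    have dS: "S ^ k * real d \<le> S ^ k * x" for k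
      using d(2) S1[of k] by (intro mult_left_mono) auto
    have inc: "S \<le> S ^ 2" "S \<le> S ^ 3" "S ^ 2 \<le> S ^ 3"
      using S(1) power_increasing[of 1 2 S] power_increasing[of 1 3 S] power_increasing[of 2 3 S] by auto
    have "S * (6 * real d + S * (12 * real d + S * (18 * real d)))
        = 6 * (S * real d) + 12 * (S ^ 2 * real d) + 18 * (S ^ 3 * real d)"
      by (simp add: algebra_simps power2_eq_square power3_eq_cube)
    also have "\<dots> \<le> 36 * (S ^ 3 * real d)"
      using mult_right_mono[OF inc(2) of_nat_0_le_iff[of d]] mult_right_mono[OF inc(3) of_nat_0_le_iff[of d]]
      by linarith
    finally have "real (reads r) + 1 \<le> 37 * (S ^ 3 * x)"
      using r(2) dS[of 3] one[of 3] by linarith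
    also have "\<dots> \<le> 37 * (T ^ 3 * x)" using le[of 3] by simp
    \<comment> \<open>Three nested passes of at most c |E| / M steps, times the M / B blocks of
      memory filled in an innermost step.\<close>
    also have "T ^ 3 * x = c ^ 3 * (real (card E) ^ 3 / (real M ^ 2 * real B))"
      using M by (simp add: T_def x_def power_mult_distrib power_divide power2_eq_square power3_eq_cube)
    finally have 1: "real (reads r) + 1 \<le> 37 * c ^ 3 * (real (card E) ^ 3 / (real M ^ 2 * real B))"
      by simp
    have 2: "real (reads r) + 1 \<le> 19 * c ^ 2 * (real (card E) ^ 2 / (real M * real B))"
      if "\<not> has_spill r"
    proof -
      have "S * (6 * real d + S * (12 * real d)) = 6 * (S * real d) + 12 * (S ^ 2 * real d)"
        by (simp add: algebra_simps power2_eq_square)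
      also have "\<dots> \<le> 18 * (S ^ 2 * real d)"
        using mult_right_mono[OF inc(1) of_nat_0_le_iff[of d]] by linarith
      finally have "real (reads r) + 1 \<le> 19 * (S ^ 2 * x)"
        using r(3)[OF that] dS[of 2] one[of 2] by linarith
      also have "\<dots> \<le> 19 * (T ^ 2 * x)" using le[of 2] by simp
      also have "T ^ 2 * x = c ^ 2 * (real (card E) ^ 2 / (real M * real B))"
        using M by (simp add: T_def x_def power_mult_distrib power_divide power2_eq_square)
      finally show ?thesis by simp
    qed
    have KC: "3 * K \<le> C * K" using C(3) K by (rule mult_right_mono)
    have "37 * c ^ 3 * (real (card E) ^ 3 / (real M ^ 2 * real B)) \<le> C * (real (card E) ^ 3 / (real M ^ 2 * real B))"
      "19 * c ^ 2 * (real (card E) ^ 2 / (real M * real B)) \<le> C * (real (card E) ^ 2 / (real M * real B))"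
      using C by (auto intro!: mult_right_mono simp del: times_divide_eq_right)
    then have "real (io_count B r) \<le> C * (real (card E) ^ 3 / (real M ^ 2 * real B) + K)"
      "\<not> has_spill r \<Longrightarrow> real (io_count B r) \<le> C * (real (card E) ^ 2 / (real M * real B) + K)"
      using io 1 2 KC unfolding distrib_left by linarith+
    then show ?thesis using r(1) unfolding K_def by blast
  qed
  then show ?thesis using \<open>C > 0\<close> by (intro exI[of _ C]) simp
qed

end
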